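(* Let $\mathfrak{A}$ be a unital C*-algebra, $\mathfrak{H}$ a Hilbert $\mathfrak{A}$-module and $\mathcal{G}:=((\mathfrak{H}_n,\omega_n))_{n\in\mathbb{N}^*}$ a *-fusion frame of $\mathfrak{H}$. Then the mapping $$\mathcal{T}_{\mathcal{G}}:\mathfrak{H}\to l_2(\mathfrak{H}),\qquad x\mapsto (\omega_nP_{\mathfrak{H}_n}(x))_{n\in\mathbb{N}^*}$$ is a well-defined bounded linear adjointable operator, and its adjoint is the operator $$\mathcal{T}_{\mathcal{G}}^*:l_2(\mathfrak{H})\to\mathfrak{H},\qquad y:=(y_n)_{n\in\mathbb{N}^*}\mapsto \mathcal{T}_{\mathcal{G}}^*(y):=\sum_{n=1}^{+\infty}\omega_nP_{\mathfrak{H}_n}(y_n).$$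
   Context: $\mathbb{N}^*=\{1,2,3,\dots\}$. Hilbert $\mathfrak{A}$-modules are left modules with $\mathfrak{A}$-valued inner product $\langle\cdot,\cdot\rangle$ that is $\mathfrak{A}$-linear in the first variable; $|x|:=\langle x,x\rangle^{1/2}\in\mathfrak{A}$ and $\|x\|_{\mathfrak{H}}:=\||x|\|_{\mathfrak{A}}$. For $a,b\in\mathfrak{A}$, $a\preccurlyeq b$ means that $b-a$ is positive. An element of $\mathfrak{A}$ is strictly positive if every nonzero positive linear form takes a value $>0$ on it; since $\mathfrak{A}$ is unital this is equivalent to being positive and invertible. A closed submodule $\mathfrak{K}$ of $\mathfrak{H}$ is orthogonally complemented if $\mathfrak{H}=\mathfrak{K}\oplus\mathfrak{K}^\perp$, where $\mathfrak{K}^\perp=\{u\in\mathfrak{H}:\langle u,x\rangle=0\ \forall x\in\mathfrak{K}\}$; $P_{\mathfrak{K}}$ denotes the corresponding orthogonal projection of $\mathfrak{H}$ onto $\mathfrak{K}$. A weight of $\mathfrak{A}$ is a sequence $(\omega_n)_{n\in\mathbb{N}^*}$ of central and strictly positive elements of $\mathfrak{A}$. Given a sequence $(\mathfrak{H}_n)_{n\in\mathbb{N}^*}$ of orthogonally complemented submodules of $\mathfrak{H}$ and a weight $(\omega_n)_{n\in\mathbb{N}^*}$ of $\mathfrak{A}$, the sequence $((\mathfrak{H}_n,\omega_n))_{n\in\mathbb{N}^*}$ is a *-fusion frame of $\mathfrak{H}$ if for each $x\in\mathfrak{H}$ the series $\sum\omega_n^2|P_{\mathfrak{H}_n}(x)|^2$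 converges in the norm of $\mathfrak{A}$ and there exist two strictly positive elements $A,B$ of $\mathfrak{A}$ such that $|Ax|^2\preccurlyeq\sum_{n=1}^{+\infty}\omega_n^2|P_{\mathfrak{H}_n}(x)|^2\preccurlyeq|Bx|^2$ for all $x\in\mathfrak{H}$. $l_2(\mathfrak{H})$ is the Hilbert $\mathfrak{A}$-module of all sequences $(y_n)_{n\in\mathbb{N}^*}$ in $\mathfrak{H}$ such that $\sum\langle y_n,y_n\rangle$ converges in the norm of $\mathfrak{A}$, with inner product $\langle y,z\rangle=\sum_{n=1}^{+\infty}\langle y_n,z_n\rangle$. A mapping $T:\mathfrak{H}\to\mathfrak{K}$ between Hilbert $\mathfrak{A}$-modules is adjointable if there is $S:\mathfrak{K}\to\mathfrak{H}$ with $\langle T(u),v\rangle=\langle u,S(v)\rangle$ for all $u\in\mathfrak{H},v\in\mathfrak{K}$; $S$ is then unique and denoted $T^*$. *)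

theory Defs
  imports "HOL-Analysis.Analysis" "HOL-Library.Function_Algebras"
begin

class unital_cstar_algebra = real_normed_algebra_1 + banach +
  fixes scaleC :: "complex \<Rightarrow> 'a \<Rightarrow> 'a"
    and star :: "'a \<Rightarrow> 'a"
  assumes scaleC_add_right: "scaleC c (a + b) = scaleC c a + scaleC c b"
    and scaleC_add_left: "scaleC (c + d) a = scaleC c a + scaleC d a"
    and scaleC_scaleC: "scaleC c (scaleC d a) = scaleC (c * d) a"
    and scaleC_of_real: "scaleC (complex_of_real r) a = scaleR r a"
    and mult_scaleC_left: "scaleC c a * b = scaleC c (a * b)"
    and mult_scaleC_right: "a * scaleC c b = scaleC c (a * b)"
    and norm_scaleC: "norm (scaleC c a) = cmod c * norm a"
    and star_star: "star (star a) = a"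
    and star_add: "star (a + b) = star a + star b"
    and star_scaleC: "star (scaleC c a) = scaleC (cnj c) (star a)"
    and star_mult: "star (a * b) = star b * star a"
    and cstar_identity: "norm (star a * a) = (norm a)\<^sup>2"

definition spectrum :: "'a::unital_cstar_algebra \<Rightarrow> complex set" where
  "spectrum a = {z. \<not> (\<exists>b. (a - scaleC z 1) * b = 1 \<and> b * (a - scaleC z 1) = 1)}"

definition cstar_positive :: "'a::unital_cstar_algebra \<Rightarrow> bool" where
  "cstar_positive a \<longleftrightarrow> star a = a \<and> spectrum a \<subseteq> complex_of_real ` {0..}"

definition cstar_le :: "'a::unital_cstar_algebra \<Rightarrow> 'a \<Rightarrow> bool" (infix "\<preceq>" 50) where
  "a \<preceq> b \<longleftrightarrow> cstar_positive (b - a)"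

definition cstar_sqrt :: "'a::unital_cstar_algebra \<Rightarrow> 'a" where
  "cstar_sqrt a = (THE b. cstar_positive b \<and> b\<^sup>2 = a)"

definition positive_form :: "('a::unital_cstar_algebra \<Rightarrow> complex) \<Rightarrow> bool" where
  "positive_form \<phi> \<longleftrightarrow>
     (\<forall>a b. \<phi> (a + b) = \<phi> a + \<phi> b) \<and> (\<forall>c a. \<phi> (scaleC c a) = c * \<phi> a) \<and>
     (\<forall>a. cstar_positive a \<longrightarrow> \<phi> a \<in> complex_of_real ` {0..})"

definition strictly_positive :: "'a::unital_cstar_algebra \<Rightarrow> bool" where
  "strictly_positive a \<longleftrightarrow>
     (\<forall>\<phi>. positive_form \<phi> \<and> (\<exists>b. \<phi> b \<noteq> 0) \<longrightarrow> \<phi> a \<in> complex_of_real ` {0<..})"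

text \<open>
  A module lives on a subgroup of the ambient additive group, so that \<open>l\<^sub>2\<close>, a set of sequences
  with pointwise addition, is a module in the same sense as the given one. As the algebra is unital,
  the complex vector space structure of a module is determined by the action: \<open>c\<close> acts as
  \<open>scaleC c 1\<close>.
\<close>

record ('a, 'h) cmodule =
  mcarrier :: "'h set"
  act :: "'a \<Rightarrow> 'h \<Rightarrow> 'h"
  ip :: "'h \<Rightarrow> 'h \<Rightarrow> 'a"

definition habs :: "('a::unital_cstar_algebra, 'h) cmodule \<Rightarrow> 'h \<Rightarrow> 'a" where
  "habs H x = cstar_sqrt (ip H x x)"

definition hnorm :: "('a::unital_cstar_algebra, 'h) cmodule \<Rightarrow> 'h \<Rightarrow> real" where
  "hnorm H x = norm (habs H x)"

definition htendsto ::
  "('a::unital_cstar_algebra, 'h::ab_group_add) cmodule \<Rightarrow> (nat \<Rightarrow> 'h) \<Rightarrow> 'h \<Rightarrow> bool" where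
  "htendsto H X l \<longleftrightarrow> l \<in> mcarrier H \<and> (\<lambda>n. hnorm H (X n - l)) \<longlonglongrightarrow> 0"

definition hcauchy ::
  "('a::unital_cstar_algebra, 'h::ab_group_add) cmodule \<Rightarrow> (nat \<Rightarrow> 'h) \<Rightarrow> bool" where
  "hcauchy H X \<longleftrightarrow> (\<forall>e>0. \<exists>N. \<forall>m\<ge>N. \<forall>n\<ge>N. hnorm H (X m - X n) < e)"

definition hsums ::
  "('a::unital_cstar_algebra, 'h::ab_group_add) cmodule \<Rightarrow> (nat \<Rightarrow> 'h) \<Rightarrow> 'h \<Rightarrow> bool" where
  "hsums H f s \<longleftrightarrow> htendsto H (\<lambda>N. \<Sum>n<N. f n) s"

locale hilbert_module =
  fixes H :: "('a::unital_cstar_algebra, 'h::ab_group_add) cmodule"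
  assumes zero_closed: "0 \<in> mcarrier H"
    and add_closed: "\<lbrakk>x \<in> mcarrier H; y \<in> mcarrier H\<rbrakk> \<Longrightarrow> x + y \<in> mcarrier H"
    and uminus_closed: "x \<in> mcarrier H \<Longrightarrow> - x \<in> mcarrier H"
    and act_closed: "x \<in> mcarrier H \<Longrightarrow> act H a x \<in> mcarrier H"
    and act_one: "x \<in> mcarrier H \<Longrightarrow> act H 1 x = x"
    and act_act: "x \<in> mcarrier H \<Longrightarrow> act H a (act H b x) = act H (a * b) x"
    and act_add_left: "x \<in> mcarrier H \<Longrightarrow> act H (a + b) x = act H a x + act H b x"
    and act_add_right:
      "\<lbrakk>x \<in> mcarrier H; y \<in> mcarrier H\<rbrakk> \<Longrightarrow> act H a (x + y) = act H a x + act H a y"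
    and ip_add: "\<lbrakk>x \<in> mcarrier H; y \<in> mcarrier H; z \<in> mcarrier H\<rbrakk>
      \<Longrightarrow> ip H (x + y) z = ip H x z + ip H y z"
    and ip_act: "\<lbrakk>x \<in> mcarrier H; y \<in> mcarrier H\<rbrakk> \<Longrightarrow> ip H (act H a x) y = a * ip H x y"
    and ip_star: "\<lbrakk>x \<in> mcarrier H; y \<in> mcarrier H\<rbrakk> \<Longrightarrow> star (ip H x y) = ip H y x"
    and ip_positive: "x \<in> mcarrier H \<Longrightarrow> cstar_positive (ip H x x)"
    and ip_definite: "\<lbrakk>x \<in> mcarrier H; ip H x x = 0\<rbrakk> \<Longrightarrow> x = 0"
    and complete: "\<lbrakk>\<And>n. X n \<in> mcarrier H; hcauchy H X\<rbrakk> \<Longrightarrow> \<exists>l. htendsto H X l"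

definition l2_module ::
  "('a::unital_cstar_algebra, 'h) cmodule \<Rightarrow> ('a, nat \<Rightarrow> 'h) cmodule" where
  "l2_module H = \<lparr>
     mcarrier = {y. (\<forall>n. y n \<in> mcarrier H) \<and> summable (\<lambda>n. ip H (y n) (y n))},
     act = (\<lambda>a y n. act H a (y n)),
     ip = (\<lambda>y z. \<Sum>n. ip H (y n) (z n)) \<rparr>"

definition bounded_linear_operator ::
  "('a::unital_cstar_algebra, 'h::ab_group_add) cmodule \<Rightarrow> ('a, 'k::ab_group_add) cmodule
     \<Rightarrow> ('h \<Rightarrow> 'k) \<Rightarrow> bool" where
  "bounded_linear_operator H K T \<longleftrightarrow>
     T \<in> mcarrier H \<rightarrow> mcarrier K \<and>
     (\<forall>x\<in>mcarrier H. \<forall>y\<in>mcarrier H. T (x + y) = T x + T y) \<and>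
     (\<forall>a. \<forall>x\<in>mcarrier H. T (act H a x) = act K a (T x)) \<and>
     (\<exists>M. \<forall>x\<in>mcarrier H. hnorm K (T x) \<le> M * hnorm H x)"

definition is_adjoint ::
  "('a, 'h) cmodule \<Rightarrow> ('a, 'k) cmodule \<Rightarrow> ('h \<Rightarrow> 'k) \<Rightarrow> ('k \<Rightarrow> 'h) \<Rightarrow> bool" where
  "is_adjoint H K T S \<longleftrightarrow>
     S \<in> mcarrier K \<rightarrow> mcarrier H \<and>
     (\<forall>u\<in>mcarrier H. \<forall>v\<in>mcarrier K. ip K (T u) v = ip H u (S v))"

definition adjointable :: "('a, 'h) cmodule \<Rightarrow> ('a, 'k) cmodule \<Rightarrow> ('h \<Rightarrow> 'k) \<Rightarrow> bool" where
  "adjointable H K T \<longleftrightarrow> T \<in> mcarrier H \<rightarrow> mcarrier K \<and> (\<exists>S. is_adjoint H K T S)"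

text \<open>The adjoint is unique only on the carrier, hence the extensionality requirement.\<close>

definition adjoint_op ::
  "('a, 'h) cmodule \<Rightarrow> ('a, 'k) cmodule \<Rightarrow> ('h \<Rightarrow> 'k) \<Rightarrow> ('k \<Rightarrow> 'h)" where
  "adjoint_op H K T = (THE S. is_adjoint H K T S \<and> S \<in> extensional (mcarrier K))"

definition closed_submodule ::
  "('a::unital_cstar_algebra, 'h::ab_group_add) cmodule \<Rightarrow> 'h set \<Rightarrow> bool" where
  "closed_submodule H K \<longleftrightarrow>
     K \<subseteq> mcarrier H \<and> 0 \<in> K \<and> (\<forall>x\<in>K. \<forall>y\<in>K. x + y \<in> K) \<and> (\<forall>a. \<forall>x\<in>K. act H a x \<in> K) \<and>
     (\<forall>X l. (\<forall>n. X n \<in> K) \<and> htendsto H X l \<longrightarrow> l \<in> K)"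

definition orth_compl ::
  "('a::unital_cstar_algebra, 'h) cmodule \<Rightarrow> 'h set \<Rightarrow> 'h set" where
  "orth_compl H K = {u \<in> mcarrier H. \<forall>x\<in>K. ip H u x = 0}"

definition orthogonally_complemented ::
  "('a::unital_cstar_algebra, 'h::ab_group_add) cmodule \<Rightarrow> 'h set \<Rightarrow> bool" where
  "orthogonally_complemented H K \<longleftrightarrow>
     closed_submodule H K \<and> K \<inter> orth_compl H K = {0} \<and>
     mcarrier H = {y + z | y z. y \<in> K \<and> z \<in> orth_compl H K}"

definition orth_proj ::
  "('a::unital_cstar_algebra, 'h::ab_group_add) cmodule \<Rightarrow> 'h set \<Rightarrow> 'h \<Rightarrow> 'h" where
  "orth_proj H K x = (THE y. y \<in> K \<and> (\<exists>z\<in>orth_compl H K. x = y + z))"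

text \<open>Sequences are indexed from \<open>0\<close>; the \<open>n\<close>-th term here is the \<open>(n + 1)\<close>-st in the usual
  numbering by positive integers.\<close>

definition cstar_weight :: "(nat \<Rightarrow> 'a::unital_cstar_algebra) \<Rightarrow> bool" where
  "cstar_weight \<omega> \<longleftrightarrow> (\<forall>n. (\<forall>a. \<omega> n * a = a * \<omega> n) \<and> strictly_positive (\<omega> n))"

definition star_fusion_frame ::
  "('a::unital_cstar_algebra, 'h::ab_group_add) cmodule \<Rightarrow> (nat \<Rightarrow> 'h set) \<Rightarrow> (nat \<Rightarrow> 'a) \<Rightarrow> bool"
  where
  "star_fusion_frame H K \<omega> \<longleftrightarrow>
     (\<forall>n. orthogonally_complemented H (K n)) \<and> cstar_weight \<omega> \<and>
     (\<forall>x\<in>mcarrier H. summable (\<lambda>n. (\<omega> n)\<^sup>2 * (habs H (orth_proj H (K n) x))\<^sup>2)) \<and>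
     (\<exists>A B. strictly_positive A \<and> strictly_positive B \<and>
        (\<forall>x\<in>mcarrier H.
           (habs H (act H A x))\<^sup>2 \<preceq> (\<Sum>n. (\<omega> n)\<^sup>2 * (habs H (orth_proj H (K n) x))\<^sup>2) \<and>
           (\<Sum>n. (\<omega> n)\<^sup>2 * (habs H (orth_proj H (K n) x))\<^sup>2) \<preceq> (habs H (act H B x))\<^sup>2))"

definition frame_transform ::
  "('a::unital_cstar_algebra, 'h::ab_group_add) cmodule \<Rightarrow> (nat \<Rightarrow> 'h set) \<Rightarrow> (nat \<Rightarrow> 'a)
     \<Rightarrow> 'h \<Rightarrow> (nat \<Rightarrow> 'h)" where
  "frame_transform H K \<omega> x = (\<lambda>n. act H (\<omega> n) (orth_proj H (K n) x))"

end

(*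
  For y in l2(H), pairing the partial sums u of Sum omega_n P_n y_n with themselves and moving the
  self-adjoint omega_n P_n to the other side, Cauchy-Schwarz and the upper frame bound give
  |u| <= C |y|; so the series converges and its sum is the adjoint of the frame transform.

  Only a rudimentary part of C*-theory enters, without continuous functional calculus or
  representations. A self-adjoint element attains its norm as modulus of a spectral value, so for
  self-adjoint a and t >= |a|, a is positive iff |t - a| <= t. This makes the positive elements a
  closed convex cone on which the norm is monotone. Square roots come from the iteration w' = (v + w^2) / 2 for
  1 - sqrt (1 - v). That strictly positive elements, defined through positive forms, are
  self-adjoint is a Hahn-Banach argument.
*)
theory Submission
  imports Defs
begin

section \<open>Spectra in a unital C*-algebra\<close>

text \<open>A bounded module map between Hilbert modules can lack an adjoint, since no Riesz
  representation is available; the adjoint must therefore be built from its series, and convergence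
  of that series on \<open>l2_module H\<close> is the analytic core. The definitions dictate which
  C*-theory is required. \<open>hnorm\<close> passes through \<open>cstar_sqrt\<close>, a definite
  description, so positive roots must exist and be unique before \<open>hnorm H x\<close> becomes
  the square root of \<open>norm (ip H x x)\<close>. Moving \<open>act H (\<omega> n)\<close> across
  the inner product produces \<open>star (\<omega> n)\<close>, while
  \<open>strictly_positive\<close> does not ask for \<open>star w = w\<close>; enough positive forms
  must be constructed to detect an element that is not self-adjoint. The norm criterion for
  positivity is the working tool because the spectrum of a sum is not controlled by those of the
  summands, whereas norms obey the triangle inequality. The constants 4 and 16 stand for the sharp 1
  in Cauchy-Schwarz; boundedness and the Cauchy property are insensitive to them.\<close>

lemma scaleC_one [simp]: "scaleC 1 a = (a::'a::unital_cstar_algebra)"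
  using scaleC_of_real[of 1 a] by simp

lemma scaleC_zero_left [simp]: "scaleC 0 a = (0::'a::unital_cstar_algebra)"
  using scaleC_of_real[of 0 a] by simp

lemma scaleC_zero_right [simp]: "scaleC c 0 = (0::'a::unital_cstar_algebra)"
  using scaleC_add_right[of c 0 0] by simp

lemma scaleC_minus_right [simp]: "scaleC c (- a) = - scaleC c (a::'a::unital_cstar_algebra)"
  using scaleC_add_right[of c a "- a"] by (simp add: eq_neg_iff_add_eq_0 add.commute)

lemma scaleC_minus_left [simp]: "scaleC (- c) a = - scaleC c (a::'a::unital_cstar_algebra)"
  using scaleC_add_left[of c "- c" a] by (simp add: eq_neg_iff_add_eq_0 add.commute)

lemma scaleC_diff_right: "scaleC c (a - b) = scaleC c a - scaleC c (b::'a::unital_cstar_algebra)"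
  using scaleC_add_right[of c a "- b"] by simp

lemma scaleC_diff_left: "scaleC (c - d) a = scaleC c a - scaleC d (a::'a::unital_cstar_algebra)"
  using scaleC_add_left[of c "- d" a] by simp

lemma scaleC_scaleR: "scaleC c (scaleR r a) = scaleC (c * of_real r) (a::'a::unital_cstar_algebra)"
  by (simp flip: scaleC_of_real add: scaleC_scaleC)

lemma star_zero [simp]: "star 0 = (0::'a::unital_cstar_algebra)"
  using star_add[of 0 "0::'a"] by simp

lemma star_minus [simp]: "star (- a) = - star (a::'a::unital_cstar_algebra)"
  using star_add[of a "- a"] by (simp add: eq_neg_iff_add_eq_0 add.commute)

lemma star_diff: "star (a - b) = star a - star (b::'a::unital_cstar_algebra)"
  using star_add[of a "- b"] by simp

lemma star_one [simp]: "star 1 = (1::'a::unital_cstar_algebra)"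
  using star_mult[of "star 1" "1::'a"] by (simp add: star_star)

lemma star_scaleR: "star (scaleR r a) = scaleR r (star (a::'a::unital_cstar_algebra))"
  using star_scaleC[of "of_real r" a] by (simp add: scaleC_of_real)

lemma star_sum: "star (\<Sum>i\<in>F. f i) = (\<Sum>i\<in>F. star (f i :: 'a::unital_cstar_algebra))"
  by (induction F rule: infinite_finite_induct) (simp_all add: star_add)

lemma norm_star [simp]: "norm (star a) = norm (a::'a::unital_cstar_algebra)"
proof -
  have le: "norm b \<le> norm (star b)" for b :: 'a
  proof (cases "b = 0")
    case False
    have "norm b * norm b \<le> norm (star b) * norm b"
      using cstar_identity[of b] norm_mult_ineq[of "star b" b] by (simp add: power2_eq_square)
    with False show ?thesis by simp
  qed simp
  show ?thesis using le[of a] le[of "star a"] by (simp add: star_star)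
qed

lemma norm_self_adjoint_square:
  "star a = a \<Longrightarrow> norm (a * a) = (norm (a::'a::unital_cstar_algebra))\<^sup>2"
  using cstar_identity[of a] by simp

lemma tendsto_star:
  fixes X :: "nat \<Rightarrow> 'a::unital_cstar_algebra"
  assumes "X \<longlonglongrightarrow> l"
  shows "(\<lambda>n. star (X n)) \<longlonglongrightarrow> star l"
proof -
  have "norm (star (X n) - star l) = norm (X n - l)" for n
    by (metis norm_star star_diff)
  then show ?thesis using assms by (simp add: tendsto_iff dist_norm)
qed

lemma star_limit:
  fixes X :: "nat \<Rightarrow> 'a::unital_cstar_algebra"
  assumes "X \<longlonglongrightarrow> l" "\<And>n. star (X n) = X n"
  shows "star l = l"
  using tendsto_star[OF assms(1)] assms LIMSEQ_unique by fastforce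

section \<open>Invertibility, Neumann series and real spectra\<close>

definition two_sided_inverse :: "'a::ring_1 \<Rightarrow> 'a \<Rightarrow> bool" where
  "two_sided_inverse a b \<longleftrightarrow> a * b = 1 \<and> b * a = 1"

lemma two_sided_inverse_mult:
  assumes "two_sided_inverse a b" "two_sided_inverse c d"
  shows "two_sided_inverse (a * c) (d * b)"
proof -
  have "a * c * (d * b) = a * (c * d) * b" "d * b * (a * c) = d * (b * a) * c"
    by (simp_all only: mult.assoc)
  then show ?thesis using assms unfolding two_sided_inverse_def by simp
qed

lemma two_sided_inverse_unique:
  "two_sided_inverse a b \<Longrightarrow> two_sided_inverse a c \<Longrightarrow> b = c"
  unfolding two_sided_inverse_def by (metis mult.assoc mult.left_neutral mult.right_neutral)

lemma not_in_spectrum_iff: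
  "z \<notin> spectrum a \<longleftrightarrow> (\<exists>b. two_sided_inverse (a - scaleC z 1) b)"
  by (simp add: spectrum_def two_sided_inverse_def)

text \<open>The series satisfies \<open>b - 1 = x + x * (b - 1)\<close>, whence the estimate; it
  makes the inverse close to \<open>1\<close> when \<open>x\<close> is small.\<close>

lemma neumann_inverse:
  fixes x :: "'a::{real_normed_algebra_1,banach}"
  assumes "norm x < 1"
  obtains b where "two_sided_inverse (1 - x) b" "norm (b - 1) \<le> norm x / (1 - norm x)"
proof -
  have s: "summable (\<lambda>n. x ^ n)"
    by (rule summable_comparison_test'[where N=0 and g="\<lambda>n. norm x ^ n"])
      (use assms in \<open>auto simp: norm_power_ineq\<close>)
  define b where "b = (\<Sum>n. x ^ n)"
  have h: "b = (\<Sum>n. x ^ Suc n) + 1"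
    using suminf_split_head[OF s] by (simp add: b_def)
  have l: "b = x * b + 1"
    using h suminf_mult[OF s, of x] by (simp add: b_def)
  have r: "b = b * x + 1"
    using h suminf_mult2[OF s, of x] by (simp add: b_def power_commutes)
  have inv: "two_sided_inverse (1 - x) b"
    using l r by (simp add: two_sided_inverse_def algebra_simps)
  have e: "b - 1 = x + x * (b - 1)" using l by (simp add: algebra_simps)
  have "norm (b - 1) \<le> norm x + norm x * norm (b - 1)"
    using norm_triangle_ineq[of x "x * (b - 1)"] norm_mult_ineq[of x "b - 1"] e by simp
  then have "norm (b - 1) \<le> norm x / (1 - norm x)"
    using assms by (simp add: field_simps)
  with inv that show ?thesis by blast
qed

lemma two_sided_inverse_scaleC:
  fixes a :: "'a::unital_cstar_algebra"
  assumes "two_sided_inverse a b" "c \<noteq> 0"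
  shows "two_sided_inverse (scaleC c a) (scaleC (inverse c) b)"
  using assms by (simp add: two_sided_inverse_def mult_scaleC_left mult_scaleC_right scaleC_scaleC)

lemma spectrum_norm_le:
  fixes a :: "'a::unital_cstar_algebra"
  assumes "z \<in> spectrum a"
  shows "cmod z \<le> norm a"
proof (rule ccontr)
  assume "\<not> cmod z \<le> norm a"
  then have lt: "norm a < cmod z" and z: "z \<noteq> 0" by auto
  have "norm (scaleC (inverse z) a) < 1"
    unfolding norm_scaleC norm_inverse using lt z by (simp add: field_simps)
  then obtain b where "two_sided_inverse (1 - scaleC (inverse z) a) b"
    by (rule neumann_inverse)
  from two_sided_inverse_scaleC[OF this, of "- z"] z
  have "two_sided_inverse (a - scaleC z 1) (scaleC (inverse (- z)) b)"
    by (simp add: scaleC_diff_right scaleC_scaleC)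
  with assms not_in_spectrum_iff show False by blast
qed

lemma two_sided_inverse_minus:
  "two_sided_inverse a b \<Longrightarrow> two_sided_inverse (- a) (- b)"
  by (simp add: two_sided_inverse_def)

lemma spectrum_add: "z \<in> spectrum (a + scaleC c 1) \<longleftrightarrow> z - c \<in> spectrum a"
proof -
  have e: "a + scaleC c 1 - scaleC z 1 = a - scaleC (z - c) 1" by (simp add: scaleC_diff_left)
  show ?thesis unfolding spectrum_def mem_Collect_eq e ..
qed

lemma spectrum_uminus: "z \<in> spectrum (- a) \<longleftrightarrow> - z \<in> spectrum a"
proof -
  have e: "- a - scaleC z 1 = - (a - scaleC (- z) 1)" by simp
  have "(\<exists>b. two_sided_inverse (- c) b) \<longleftrightarrow> (\<exists>b. two_sided_inverse c b)" for c :: 'a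
    using two_sided_inverse_minus[of c] two_sided_inverse_minus[of "- c"] by fastforce
  then show ?thesis unfolding e not_in_spectrum_iff[symmetric]
    by (metis e not_in_spectrum_iff)
qed

lemma spectrum_reflect: "z \<in> spectrum (scaleC c 1 - a) \<longleftrightarrow> c - z \<in> spectrum a"
  using spectrum_add[of z "- a" c] by (simp add: spectrum_uminus)

text \<open>Shift \<open>a\<close> by \<open>\<i> * s\<close>. Both sides of the norm estimate
  contain \<open>s^2\<close>, which cancels; the remaining term \<open>2 * Im z * s\<close> is
  unbounded in \<open>s\<close> unless \<open>Im z = 0\<close>.\<close>

lemma self_adjoint_spectrum_real:
  fixes a :: "'a::unital_cstar_algebra"
  assumes sa: "star a = a" and z: "z \<in> spectrum a"
  shows "Im z = 0"
proof -
  have bound: "(Re z)\<^sup>2 + (Im z)\<^sup>2 + 2 * Im z * s \<le> (norm a)\<^sup>2" for s :: real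
  proof -
    define c where "c = \<i> * of_real s"
    have "z + c \<in> spectrum (a + scaleC c 1)" using z by (simp add: spectrum_add)
    then have "(cmod (z + c))\<^sup>2 \<le> (norm (a + scaleC c 1))\<^sup>2"
      by (intro power_mono spectrum_norm_le) auto
    also have "\<dots> = norm ((a - scaleC c 1) * (a + scaleC c 1))"
      by (simp flip: cstar_identity add: star_add star_scaleC sa c_def)
    also have "(a - scaleC c 1) * (a + scaleC c 1) = a * a + scaleR (s\<^sup>2) 1"
      by (simp add: algebra_simps mult_scaleC_left mult_scaleC_right scaleC_scaleC c_def
        scaleC_diff_right power2_eq_square flip: scaleC_of_real)
    also have "norm \<dots> \<le> (norm a)\<^sup>2 + s\<^sup>2"
      by (rule norm_triangle_le) (simp add: norm_mult_ineq power2_eq_square)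
    finally show ?thesis
      unfolding cmod_power2 by (simp add: c_def power2_eq_square algebra_simps)
  qed
  show ?thesis
  proof (rule ccontr)
    assume n: "Im z \<noteq> 0"
    have "2 * Im z * (((norm a)\<^sup>2 + 1) / (2 * Im z)) = (norm a)\<^sup>2 + 1" using n by simp
    with bound[of "((norm a)\<^sup>2 + 1) / (2 * Im z)"] show False
      by (smt (verit) zero_le_power2)
  qed
qed

lemma scaleR_eq_scaleC: "scaleR r a = scaleC (of_real r) (a::'a::unital_cstar_algebra)"
  by (simp add: scaleC_of_real)

section \<open>Self-adjoint elements attain their norm on the spectrum\<close>

lemma two_sided_inverse_one_minus_square:
  fixes x :: "'a::real_normed_algebra_1"
  assumes "two_sided_inverse (1 - x) b" "two_sided_inverse (1 + x) c"
  shows "two_sided_inverse (1 - x * x) (scaleR (1/2) (b + c))"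
proof -
  have e: "1 - x * x = (1 + x) * (1 - x)" "1 - x * x = (1 - x) * (1 + x)"
    by (simp_all add: algebra_simps)
  have "(1 - x * x) * b = 1 + x" unfolding e(1)
    using assms(1) by (simp add: two_sided_inverse_def mult.assoc)
  moreover have "(1 - x * x) * c = 1 - x" unfolding e(2)
    using assms(2) by (simp add: two_sided_inverse_def mult.assoc)
  moreover have "b * (1 - x * x) = 1 + x" unfolding e(2)
    using assms(1) by (simp add: two_sided_inverse_def flip: mult.assoc)
  moreover have "c * (1 - x * x) = 1 - x" unfolding e(1)
    using assms(2) by (simp add: two_sided_inverse_def flip: mult.assoc)
  moreover have "scaleR (1/2) (1 + 1) = (1::'a)"
    by (metis scaleR_half_double)
  ultimately show ?thesis
    by (simp add: two_sided_inverse_def distrib_left distrib_right)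
qed

lemma star_power: "star a = a \<Longrightarrow> star (a ^ n) = (a::'a::unital_cstar_algebra) ^ n"
  by (induction n) (simp_all add: star_mult power_commutes)

text \<open>The C*-identity controls squares of self-adjoint elements, hence the exponents
  \<open>2 ^ n\<close>.\<close>

lemma norm_self_adjoint_power2:
  fixes h :: "'a::unital_cstar_algebra"
  assumes "star h = h"
  shows "norm (h ^ (2 ^ n)) = norm h ^ (2 ^ n)"
proof (induction n)
  case (Suc n)
  have "h ^ (2 ^ Suc n) = h ^ (2 ^ n) * h ^ (2 ^ n)"
    by (simp add: mult_2 power_add)
  then show ?case
    using Suc norm_self_adjoint_square[OF star_power[OF assms]]
    by (simp add: power_mult power2_eq_square mult_2 power_add)
qed simp

text \<open>The resolvent identity bounds \<open>norm (R w - R z)\<close> by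
  \<open>cmod (w - z) * norm (R w) * m\<close>. For \<open>w\<close> near \<open>z\<close> the
  unknown \<open>norm (R w)\<close> can be absorbed, so \<open>R\<close> is continuous and bounded
  on a compact set.\<close>

lemma resolvent_bounded:
  fixes h :: "'a::unital_cstar_algebra"
  assumes S: "compact S" and R: "\<And>z. z \<in> S \<Longrightarrow> two_sided_inverse (1 - scaleC z h) (R z)"
  shows resolvent_identity:
      "\<And>z w. z \<in> S \<Longrightarrow> w \<in> S \<Longrightarrow> R w - R z = scaleC (w - z) (R w * h * R z)"
    and "bounded (R ` S)"
proof -
  show id: "R w - R z = scaleC (w - z) (R w * h * R z)" if "z \<in> S" "w \<in> S" for z w
  proof -
    have "R w * ((1 - scaleC z h) - (1 - scaleC w h)) * R z
        = R w * ((1 - scaleC z h) * R z) - (R w * (1 - scaleC w h)) * R z"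
      by (simp add: algebra_simps)
    then have "R w * ((1 - scaleC z h) - (1 - scaleC w h)) * R z = R w - R z"
      using R[OF that(1)] R[OF that(2)] by (simp add: two_sided_inverse_def)
    moreover have "(1 - scaleC z h) - (1 - scaleC w h) = scaleC (w - z) h"
      by (simp add: scaleC_diff_left)
    ultimately show ?thesis by (simp add: mult_scaleC_left mult_scaleC_right)
  qed
  have "continuous_on S R"
  proof (unfold continuous_on_def, rule ballI)
    fix z assume z: "z \<in> S"
    define m where "m = norm (R z) * norm h"
    have m: "m \<ge> 0" by (simp add: m_def)
    have step: "norm (R w - R z) \<le> cmod (w - z) * (norm (R w) * m)" if "w \<in> S" for w
    proof -
      have "norm (R w * h * R z) \<le> norm (R w) * norm h * norm (R z)"
        by (meson mult_right_mono norm_ge_zero norm_mult_ineq order_trans)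
      then show ?thesis unfolding id[OF z that] norm_scaleC m_def
        by (intro mult_left_mono) (auto simp: mult_ac)
    qed
    \<comment> \<open>Within this radius \<open>norm (R w - R z)\<close> is at most
      \<open>norm (R w) / 2\<close>, so \<open>norm (R w) \<le> 2 * norm (R z)\<close>. The
      \<open>+ 1\<close> keeps the radius meaningful for \<open>m = 0\<close>.\<close>
    have bd: "norm (R w - R z) \<le> cmod (w - z) * (2 * norm (R z) * m)"
      if w: "w \<in> S" "cmod (w - z) < 1 / (2 * (m + 1))" for w
    proof -
      have "cmod (w - z) * m \<le> cmod (w - z) * (m + 1)" by (intro mult_left_mono) auto
      also have "\<dots> \<le> 1/2" using w(2) m by (simp add: field_simps)
      finally have "cmod (w - z) * m * norm (R w) \<le> 1/2 * norm (R w)"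
        by (rule mult_right_mono) simp
      then have "norm (R w) - norm (R z) \<le> 1/2 * norm (R w)"
        using step[OF w(1)] norm_triangle_ineq2[of "R w" "R z"] by (simp add: mult_ac)
      then have "norm (R w) \<le> 2 * norm (R z)" by simp
      then have "cmod (w - z) * (norm (R w) * m) \<le> cmod (w - z) * (2 * norm (R z) * m)"
        by (intro mult_left_mono mult_right_mono) (use m in auto)
      with step[OF w(1)] show ?thesis by linarith
    qed
    have ev: "\<forall>\<^sub>F w in at z within S. norm (R w - R z) \<le> cmod (w - z) * (2 * norm (R z) * m)"
      unfolding eventually_at
      by (rule exI[of _ "1 / (2 * (m + 1))"]) (use m bd in \<open>auto simp: dist_norm\<close>)
    have "((\<lambda>w. cmod (w - z) * (2 * norm (R z) * m)) \<longlongrightarrow> cmod (z - z) * (2 * norm (R z) * m))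
        (at z within S)"
      by (intro tendsto_intros)
    then have "((\<lambda>w. R w - R z) \<longlongrightarrow> 0) (at z within S)"
      by (intro Lim_null_comparison[OF ev]) simp
    then show "(R \<longlongrightarrow> R z) (at z within S)" by (simp add: LIM_zero_iff)
  qed
  then show "bounded (R ` S)"
    using S compact_continuous_image compact_imp_bounded by blast
qed

text \<open>
  If \<open>1 - z h\<close> were invertible on the closed unit disc, then its inverses at \<open>z\<close> and \<open>r z\<close>, with
  \<open>r < 1\<close> close to \<open>1\<close>, would be uniformly close. The identity
  \<open>(1 - x\<^sup>2)\<^sup>-\<^sup>1 = ((1 - x)\<^sup>-\<^sup>1 + (1 + x)\<^sup>-\<^sup>1) / 2\<close> carries this over to \<open>h ^ N\<close> with \<open>N = 2 ^ n\<close>,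
  \<open>z\<close> and \<open>r ^ N z\<close>. For large \<open>n\<close> the second inverse is close to \<open>1\<close>, hence so is
  \<open>(1 - h ^ N)\<^sup>-\<^sup>1\<close>, contradicting \<open>\<parallel>h ^ N\<parallel> = 1\<close>.
\<close>

lemma self_adjoint_singular_on_circle:
  fixes h :: "'a::unital_cstar_algebra"
  assumes sa: "star h = h" and nh: "norm h = 1"
  shows "\<exists>z. cmod z = 1 \<and> \<not> (\<exists>b. two_sided_inverse (1 - scaleC z h) b)"
proof (rule ccontr)
  assume neg: "\<not> ?thesis"
  have "\<exists>b. two_sided_inverse (1 - scaleC z h) b" if z: "z \<in> cball 0 1" for z
  proof (cases "cmod z = 1")
    case False
    then have "norm (scaleC z h) < 1" using z nh by (simp add: norm_scaleC)
    then show ?thesis by (rule neumann_inverse) blast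
  qed (use neg in blast)
  then obtain R where R: "\<And>z. z \<in> cball 0 1 \<Longrightarrow> two_sided_inverse (1 - scaleC z h) (R z)"
    by metis
  obtain M where M: "\<And>z. z \<in> cball 0 1 \<Longrightarrow> norm (R z) \<le> M"
    using resolvent_bounded(2)[OF compact_cball R] unfolding bounded_iff by blast
  have M0: "M \<ge> 0" by (rule order_trans[OF norm_ge_zero M[of 0]]) simp
  define q where "q = M\<^sup>2 + 1"
  have q: "q \<ge> 1" "M\<^sup>2 \<le> q" by (auto simp: q_def)
  \<comment> \<open>Chosen so that \<open>(1 - r) * M^2 \<le> 1/8\<close>, the distance with which
    the induction starts.\<close>
  define r where "r = 1 - 1 / (8 * q)"
  have r: "0 < r" "r < 1" using q(1) by (simp_all add: r_def field_simps)
  have D: "(1 - r) * M\<^sup>2 \<le> 1/8" using q by (simp add: r_def field_simps)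
  have key: "cmod z \<le> 1 \<Longrightarrow> \<exists>I J. two_sided_inverse (1 - scaleC z (h ^ (2 ^ n))) I \<and>
      two_sided_inverse (1 - scaleC (of_real (r ^ (2 ^ n)) * z) (h ^ (2 ^ n))) J \<and>
      norm (I - J) \<le> 1/8" for n z
  proof (induction n arbitrary: z)
    case 0
    have z: "z \<in> cball 0 1" "of_real r * z \<in> cball 0 1"
      using 0 r by (auto simp: norm_mult mult_le_one)
    have "norm (R z - R (of_real r * z)) =
        cmod (z - of_real r * z) * norm (R z * h * R (of_real r * z))"
      using resolvent_identity[OF compact_cball R z(2,1)] by (simp add: norm_scaleC)
    also have "z - of_real r * z = of_real (1 - r) * z" by (simp add: algebra_simps)
    also have "cmod \<dots> * norm (R z * h * R (of_real r * z)) \<le> (1 - r) * 1 * (M * 1 * M)"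
    proof (intro mult_mono)
      show "cmod (of_real (1 - r) * z) \<le> (1 - r) * 1"
        using 0 r unfolding norm_mult norm_of_real by (intro mult_mono) auto
      have "norm (R z * h * R (of_real r * z)) \<le> norm (R z) * norm h * norm (R (of_real r * z))"
        by (meson mult_right_mono norm_ge_zero norm_mult_ineq order_trans)
      also have "\<dots> \<le> M * 1 * M"
        using M[OF z(1)] M[OF z(2)] M0 nh by (intro mult_mono) auto
      finally show "norm (R z * h * R (of_real r * z)) \<le> M * 1 * M" .
    qed (use r in auto)
    also have "\<dots> \<le> 1/8" using D by (simp add: power2_eq_square)
    finally show ?case using R[OF z(1)] R[OF z(2)] by auto
  next
    case (Suc n)
    \<comment> \<open>The induction hypothesis is used at both roots \<open>w\<close> and
      \<open>- w\<close> of \<open>z\<close>. Averaging the two estimates gives \<open>1/8\<close>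
      again, so the error does not grow with \<open>n\<close>.\<close>
    define w where "w = csqrt z"
    define N :: nat where "N = 2 ^ n"
    have w2: "w * w = z" unfolding w_def by (metis power2_csqrt power2_eq_square)
    have "(cmod w)\<^sup>2 = cmod z" unfolding w2[symmetric] norm_mult power2_eq_square ..
    then have w: "cmod w \<le> 1" "cmod (- w) \<le> 1"
      using Suc.prems power_le_one_iff[of "cmod w" 2] by auto
    have N2: "2 ^ Suc n = N + N" by (simp add: N_def)
    obtain I J where IJ: "two_sided_inverse (1 - scaleC w (h ^ N)) I"
        "two_sided_inverse (1 - scaleC (of_real (r ^ N) * w) (h ^ N)) J" "norm (I - J) \<le> 1/8"
      using Suc.IH[OF w(1)] unfolding N_def by blast
    obtain I' J' where IJ': "two_sided_inverse (1 + scaleC w (h ^ N)) I'"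
        "two_sided_inverse (1 + scaleC (of_real (r ^ N) * w) (h ^ N)) J'" "norm (I' - J') \<le> 1/8"
      using Suc.IH[OF w(2)] unfolding N_def by auto
    have sq: "scaleC c (h ^ N) * scaleC c (h ^ N) = scaleC (c * c) (h ^ (2 ^ Suc n))" for c
      unfolding N2 by (simp add: mult_scaleC_left mult_scaleC_right scaleC_scaleC power_add)
    have rw: "of_real (r ^ N) * w * (of_real (r ^ N) * w) = of_real (r ^ (2 ^ Suc n)) * z"
      unfolding N2 w2[symmetric] by (simp add: power_add)
    have "scaleR (1/2) (I + I') - scaleR (1/2) (J + J') = scaleR (1/2) ((I - J) + (I' - J'))"
      by (simp add: algebra_simps)
    then have "norm (scaleR (1/2) (I + I') - scaleR (1/2) (J + J')) = norm ((I - J) + (I' - J')) / 2"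
      by simp
    also have "\<dots> \<le> (norm (I - J) + norm (I' - J')) / 2"
      by (simp add: norm_triangle_ineq)
    also have "\<dots> \<le> 1/8" using IJ(3) IJ'(3) by simp
    finally show ?case
      using two_sided_inverse_one_minus_square[OF IJ(1) IJ'(1)]
        two_sided_inverse_one_minus_square[OF IJ(2) IJ'(2)]
      unfolding sq rw w2 by blast
  qed
  \<comment> \<open>\<open>norm x < 1/9\<close> puts \<open>J\<close> within \<open>1/8\<close> of
    \<open>1\<close>, hence \<open>I\<close> within \<open>1/4\<close>; then
    \<open>g = (I - 1) * (1 - g)\<close> would have norm at most \<open>1/2\<close>.\<close>
  obtain n where "r ^ n < 1/9" using real_arch_pow_inv[of "1/9" r] r by auto
  moreover have "r ^ (2 ^ n) \<le> r ^ n"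
    using r by (intro power_decreasing) (auto simp: less_imp_le)
  ultimately have rn: "r ^ (2 ^ n) < 1/9" by linarith
  define g where "g = h ^ (2 ^ n)"
  have g: "norm g = 1" unfolding g_def using norm_self_adjoint_power2[OF sa] nh by simp
  obtain I J where I: "two_sided_inverse (1 - g) I"
    and J: "two_sided_inverse (1 - scaleC (of_real (r ^ (2 ^ n))) g) J"
    and IJ: "norm (I - J) \<le> 1/8"
    using key[of 1 n] by (auto simp: g_def)
  define x where "x = scaleC (of_real (r ^ (2 ^ n))) g"
  have x: "norm x < 1/9"
    using rn r g by (simp add: x_def norm_scaleC norm_power del: of_real_power)
  obtain J' where J': "two_sided_inverse (1 - x) J'" "norm (J' - 1) \<le> norm x / (1 - norm x)"
    using neumann_inverse[of x] x by auto
  have "J' = J" using two_sided_inverse_unique J J'(1) x_def by blast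
  moreover have "norm x / (1 - norm x) \<le> 1/8" using x by (simp add: field_simps)
  ultimately have "norm (J - 1) \<le> 1/8" using J'(2) order_trans by blast
  then have I1: "norm (I - 1) \<le> 1/4" using IJ norm_triangle_ineq[of "I - J" "J - 1"] by simp
  have "I * (1 - g) = 1" using I by (simp add: two_sided_inverse_def)
  then have "(I - 1) * (1 - g) = g" by (simp add: left_diff_distrib)
  then have "1 \<le> norm (I - 1) * norm (1 - g)" using norm_mult_ineq[of "I - 1" "1 - g"] g by simp
  also have "\<dots> \<le> 1/4 * 2" using I1 norm_triangle_ineq4[of 1 g] g by (intro mult_mono) auto
  finally show False by simp
qed

lemma self_adjoint_spectral_radius:
  fixes h :: "'a::unital_cstar_algebra"
  assumes sa: "star h = h"
  shows "\<exists>z\<in>spectrum h. cmod z = norm h"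
proof (cases "h = 0")
  case True
  have "0 \<in> spectrum (0::'a)" by (simp add: spectrum_def)
  with True show ?thesis by force
next
  case False
  define g where "g = scaleR (1 / norm h) h"
  have "star g = g" "norm g = 1" using sa False by (auto simp: g_def star_scaleR)
  then obtain z where z: "cmod z = 1" "\<not> (\<exists>b. two_sided_inverse (1 - scaleC z g) b)"
    using self_adjoint_singular_on_circle by blast
  define c where "c = of_real (norm h) / z"
  have z0: "z \<noteq> 0" using z by auto
  have c0: "c \<noteq> 0" using z0 False by (simp add: c_def)
  have "scaleC (- (1 / c)) (h - scaleC c 1) = 1 - scaleC z g"
    using z0 c0 False
    by (simp add: g_def scaleC_diff_right scaleC_scaleC scaleC_scaleR c_def)
  moreover have "- (1 / c) \<noteq> 0" using c0 by simp
  ultimately have "c \<in> spectrum h"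
    using z(2) not_in_spectrum_iff[of c h] two_sided_inverse_scaleC[of "h - scaleC c 1" _ "- (1 / c)"]
    by fastforce
  moreover have "cmod c = norm h" by (simp add: c_def norm_divide z(1))
  ultimately show ?thesis by blast
qed

section \<open>The cone of positive elements\<close>

lemma cstar_positive_iff:
  "cstar_positive a \<longleftrightarrow> star a = a \<and> (\<forall>z\<in>spectrum a. 0 \<le> Re z)"
proof -
  have "z \<in> complex_of_real ` {0..} \<longleftrightarrow> Im z = 0 \<and> 0 \<le> Re z" for z
    by (auto simp: complex_eq_iff image_iff)
  then show ?thesis
    unfolding cstar_positive_def using self_adjoint_spectrum_real[of a] by blast
qed

lemma cstar_positive_star: "cstar_positive a \<Longrightarrow> star a = a"
  by (simp add: cstar_positive_def)

lemma cstar_positiveI_norm: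
  fixes a :: "'a::unital_cstar_algebra"
  assumes "star a = a" "norm (scaleR t 1 - a) \<le> t"
  shows "cstar_positive a"
  unfolding cstar_positive_iff
proof (intro conjI ballI)
  fix z assume "z \<in> spectrum a"
  then have "of_real t - z \<in> spectrum (scaleC (of_real t) 1 - a)" by (simp add: spectrum_reflect)
  then have "cmod (of_real t - z) \<le> t"
    using spectrum_norm_le assms(2) by (fastforce simp: scaleR_eq_scaleC)
  then show "0 \<le> Re z" using complex_Re_le_cmod[of "of_real t - z"] by simp
qed (fact assms(1))

text \<open>The norm of \<open>t - a\<close> is the modulus of some \<open>z\<close> in its
  spectrum, and \<open>t - z\<close> lies in the spectrum of \<open>a\<close>, hence in the interval
  from \<open>0\<close> to \<open>t\<close>; so does \<open>z\<close>.\<close>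

lemma cstar_positive_normD:
  fixes a :: "'a::unital_cstar_algebra"
  assumes p: "cstar_positive a" and t: "norm a \<le> t"
  shows "norm (scaleR t 1 - a) \<le> t"
proof -
  have "star (scaleR t 1 - a) = scaleR t 1 - a"
    using p by (simp add: star_diff star_scaleR cstar_positive_star)
  then obtain z where z: "z \<in> spectrum (scaleR t 1 - a)" "cmod z = norm (scaleR t 1 - a)"
    using self_adjoint_spectral_radius by blast
  then have w: "of_real t - z \<in> spectrum a" by (simp add: scaleR_eq_scaleC spectrum_reflect)
  then have "Im (of_real t - z) = 0" "0 \<le> Re (of_real t - z)"
    using p w self_adjoint_spectrum_real[OF _ w] unfolding cstar_positive_iff by blast+
  moreover have "Re (of_real t - z) \<le> t"
    using complex_Re_le_cmod[of "of_real t - z"] spectrum_norm_le[OF w] t by linarith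
  ultimately have "cmod z \<le> t" by (simp add: cmod_eq_Re)
  with z show ?thesis by simp
qed

lemma cstar_positive_zero [simp]: "cstar_positive (0::'a::unital_cstar_algebra)"
  by (rule cstar_positiveI_norm[of _ 0]) auto

text \<open>With \<open>t = norm a + norm b\<close> the norm criterion for the sum is the triangle
  inequality.\<close>

lemma cstar_positive_add:
  fixes a b :: "'a::unital_cstar_algebra"
  assumes "cstar_positive a" "cstar_positive b"
  shows "cstar_positive (a + b)"
proof (rule cstar_positiveI_norm)
  show "star (a + b) = a + b" using assms by (simp add: star_add cstar_positive_star)
  have "scaleR (norm a + norm b) 1 - (a + b) = (scaleR (norm a) 1 - a) + (scaleR (norm b) 1 - b)"
    by (simp add: algebra_simps)
  then show "norm (scaleR (norm a + norm b) 1 - (a + b)) \<le> norm a + norm b"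
    using cstar_positive_normD[OF assms(1)] cstar_positive_normD[OF assms(2)]
    by (metis add_mono norm_triangle_le order_refl)
qed

lemma cstar_positive_scaleR:
  fixes a :: "'a::unital_cstar_algebra"
  assumes "cstar_positive a" "0 \<le> r"
  shows "cstar_positive (scaleR r a)"
proof (rule cstar_positiveI_norm)
  show "star (scaleR r a) = scaleR r a" using assms by (simp add: star_scaleR cstar_positive_star)
  have "scaleR (r * norm a) 1 - scaleR r a = scaleR r (scaleR (norm a) 1 - a)"
    by (simp add: scaleR_diff_right)
  then show "norm (scaleR (r * norm a) 1 - scaleR r a) \<le> r * norm a"
    using cstar_positive_normD[OF assms(1)] assms(2) by (simp add: mult_left_mono)
qed

lemma cstar_positive_sum:
  "(\<And>i. i \<in> F \<Longrightarrow> cstar_positive (f i)) \<Longrightarrow> cstar_positive (\<Sum>i\<in>F. f i :: 'a::unital_cstar_algebra)"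
  by (induction F rule: infinite_finite_induct) (auto intro: cstar_positive_add)

lemma cstar_positive_limit:
  fixes X :: "nat \<Rightarrow> 'a::unital_cstar_algebra"
  assumes X: "X \<longlonglongrightarrow> l" and p: "\<And>n. cstar_positive (X n)"
  shows "cstar_positive l"
proof (rule cstar_positiveI_norm)
  show "star l = l" using star_limit[OF X] p cstar_positive_star by blast
  have "(\<lambda>n. norm (scaleR (norm (X n)) 1 - X n)) \<longlonglongrightarrow> norm (scaleR (norm l) 1 - l)"
    by (intro tendsto_intros X)
  moreover have "(\<lambda>n. norm (X n)) \<longlonglongrightarrow> norm l" by (intro tendsto_intros X)
  ultimately show "norm (scaleR (norm l) 1 - l) \<le> norm l"
    using cstar_positive_normD[OF p] by (intro LIMSEQ_le) auto
qed

lemma self_adjoint_le_norm: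
  fixes a :: "'a::unital_cstar_algebra"
  assumes "star a = a" "norm a \<le> t"
  shows "cstar_positive (scaleR t 1 - a)"
  unfolding cstar_positive_iff
proof (intro conjI ballI)
  fix z assume "z \<in> spectrum (scaleR t 1 - a)"
  then have "of_real t - z \<in> spectrum a" by (simp add: scaleR_eq_scaleC spectrum_reflect)
  then have "cmod (of_real t - z) \<le> t" using spectrum_norm_le assms(2) order_trans by blast
  then show "0 \<le> Re z" using complex_Re_le_cmod[of "of_real t - z"] by simp
qed (simp add: assms(1) star_diff star_scaleR)

text \<open>From \<open>a \<preceq> b \<preceq> norm b\<close> the spectral value of
  \<open>a\<close> with modulus \<open>norm a\<close> cannot exceed \<open>norm b\<close>.\<close>

lemma cstar_norm_mono:
  fixes a b :: "'a::unital_cstar_algebra"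
  assumes "cstar_positive a" "a \<preceq> b"
  shows "norm a \<le> norm b"
proof -
  have b: "star b = b"
    using assms star_diff[of b a] by (simp add: cstar_le_def cstar_positive_def)
  have "cstar_positive ((scaleR (norm b) 1 - b) + (b - a))"
    using assms self_adjoint_le_norm[OF b] by (intro cstar_positive_add) (auto simp: cstar_le_def)
  then have c: "cstar_positive (scaleR (norm b) 1 - a)" by simp
  obtain z where z: "z \<in> spectrum a" "cmod z = norm a"
    using self_adjoint_spectral_radius cstar_positive_star[OF assms(1)] by blast
  have "of_real (norm b) - z \<in> spectrum (scaleR (norm b) 1 - a)"
    using z(1) by (simp add: scaleR_eq_scaleC spectrum_reflect)
  then have "Re z \<le> norm b" using c by (fastforce simp: cstar_positive_iff)
  moreover have "Im z = 0" "0 \<le> Re z"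
    using z assms(1) self_adjoint_spectrum_real by (auto simp: cstar_positive_iff)
  ultimately show ?thesis using z(2) by (simp add: cmod_eq_Re)
qed

lemma cstar_positive_antisym:
  fixes a :: "'a::unital_cstar_algebra"
  assumes "cstar_positive a" "cstar_positive (- a)"
  shows "a = 0"
  using cstar_norm_mono[OF assms(1), of 0] assms(2) by (simp add: cstar_le_def)

text \<open>If \<open>w * w = z\<close>, then \<open>a * a - z\<close> factors as
  \<open>(a - w) * (a + w)\<close>, so \<open>w\<close> or \<open>- w\<close> is in the real
  spectrum of \<open>a\<close> and \<open>z\<close> is the square of a real number.\<close>

lemma cstar_positive_square:
  fixes a :: "'a::unital_cstar_algebra"
  assumes sa: "star a = a"
  shows "cstar_positive (a * a)"
  unfolding cstar_positive_iff
proof (intro conjI ballI)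
  fix z assume z: "z \<in> spectrum (a * a)"
  define w where "w = csqrt z"
  have w2: "w * w = z" unfolding w_def by (metis power2_csqrt power2_eq_square)
  have e: "a * a - scaleC z 1 = (a - scaleC w 1) * (a - scaleC (- w) 1)"
    by (simp add: algebra_simps mult_scaleC_left mult_scaleC_right scaleC_scaleC w2 scaleC_diff_right)
  have "w \<in> spectrum a \<or> - w \<in> spectrum a"
  proof (rule ccontr)
    assume "\<not> ?thesis"
    then obtain b c where "two_sided_inverse (a - scaleC w 1) b"
        "two_sided_inverse (a - scaleC (- w) 1) c"
      unfolding not_in_spectrum_iff de_Morgan_disj by blast
    then have "two_sided_inverse (a * a - scaleC z 1) (c * b)"
      unfolding e by (rule two_sided_inverse_mult)
    with z not_in_spectrum_iff show False by blast
  qed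
  then have "Im w = 0" using self_adjoint_spectrum_real[OF sa] by fastforce
  then show "0 \<le> Re z" by (simp flip: w2)
qed (simp add: star_mult sa)

section \<open>Square roots\<close>

text \<open>The general type lets the iteration run in the reals too: the real sequence for
  \<open>v = 1\<close> majorises every sequence with \<open>norm v \<le> 1\<close>.\<close>

primrec sqrt_iteration :: "'a::real_normed_algebra_1 \<Rightarrow> nat \<Rightarrow> 'a" where
  "sqrt_iteration v 0 = 0"
| "sqrt_iteration v (Suc n) = scaleR (1/2) (v + sqrt_iteration v n * sqrt_iteration v n)"

lemma sqrt_iteration_real:
  "0 \<le> sqrt_iteration (1::real) n \<and> sqrt_iteration (1::real) n \<le> 1 \<and>
   sqrt_iteration (1::real) n \<le> sqrt_iteration 1 (Suc n)"
proof (induction n)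
  case (Suc n)
  define r where "r = sqrt_iteration (1::real) (Suc n)"
  have s: "0 \<le> sqrt_iteration (1::real) n" "sqrt_iteration (1::real) n \<le> 1" using Suc by auto
  have "0 \<le> r" "r \<le> 1"
    using mult_nonneg_nonneg[OF s(1) s(1)] mult_le_one[OF s(2) s(1) s(2)] by (simp_all add: r_def)
  moreover have "r \<le> 1/2 * (1 + r * r)" using zero_le_square[of "1 - r"] by (simp add: algebra_simps)
  ultimately show ?case by (simp add: r_def)
qed simp

lemma sqrt_iteration_commute:
  "v * c = c * v \<Longrightarrow> sqrt_iteration v n * c = c * sqrt_iteration v n"
proof (induction n)
  case (Suc n)
  define w where "w = sqrt_iteration v n"
  have w: "w * c = c * w" using Suc by (simp add: w_def)
  have "w * w * c = w * c * w" by (simp only: mult.assoc) (simp only: w)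
  also have "\<dots> = c * (w * w)" unfolding w by (rule mult.assoc)
  finally show ?case
    using Suc.prems by (simp add: distrib_left distrib_right flip: w_def)
qed simp

lemma sqrt_iteration_norm:
  assumes "norm v \<le> 1"
  shows "norm (sqrt_iteration v n) \<le> sqrt_iteration 1 n"
proof (induction n)
  case (Suc n)
  have "norm (sqrt_iteration v n * sqrt_iteration v n) \<le> sqrt_iteration 1 n * sqrt_iteration 1 n"
    by (rule order_trans[OF norm_mult_ineq mult_mono[OF Suc Suc]])
      (simp_all add: sqrt_iteration_real)
  then show ?case
    using assms norm_triangle_ineq[of v "sqrt_iteration v n * sqrt_iteration v n"] by simp
qed simp

text \<open>Iterates commute, so \<open>x * x - y * y = (x - y) * (x + y)\<close>, and each factor
  is bounded by its real counterpart. The increments are thus dominated by those of a bounded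
  increasing real sequence.\<close>

lemma sqrt_iteration_diff:
  assumes v: "norm v \<le> 1"
  shows "norm (sqrt_iteration v (Suc n) - sqrt_iteration v n)
    \<le> sqrt_iteration 1 (Suc n) - sqrt_iteration 1 n"
proof (induction n)
  case (Suc n)
  define x where "x = sqrt_iteration v (Suc n)"
  define y where "y = sqrt_iteration v n"
  define r :: real where "r = sqrt_iteration 1 (Suc n)"
  define s :: real where "s = sqrt_iteration 1 n"
  have vy: "v * y = y * v" unfolding y_def by (rule sqrt_iteration_commute[symmetric]) simp
  have xy: "x * y = y * x" unfolding x_def by (rule sqrt_iteration_commute) (rule vy)
  have b: "norm (x + y) \<le> r + s"
    using sqrt_iteration_norm[OF v, of "Suc n"] sqrt_iteration_norm[OF v, of n]
    unfolding x_def y_def r_def s_def by (rule norm_triangle_le[OF add_mono])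
  have "sqrt_iteration v (Suc (Suc n)) - sqrt_iteration v (Suc n)
      = scaleR (1/2) (v + x * x) - scaleR (1/2) (v + y * y)"
    by (simp add: x_def y_def)
  also have "\<dots> = scaleR (1/2) (x * x - y * y)" by (simp add: scaleR_add_right scaleR_diff_right)
  also have "x * x - y * y = (x - y) * (x + y)"
    using xy by (simp add: left_diff_distrib distrib_left)
  finally have eq: "sqrt_iteration v (Suc (Suc n)) - sqrt_iteration v (Suc n)
      = scaleR (1/2) ((x - y) * (x + y))" .
  have d: "norm (x - y) \<le> r - s" using Suc by (simp only: x_def y_def r_def s_def)
  have "norm ((x - y) * (x + y)) \<le> (r - s) * (r + s)"
    by (rule order_trans[OF norm_mult_ineq mult_mono[OF d b]]) (use order_trans[OF norm_ge_zero d] in simp_all)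
  then have "norm (sqrt_iteration v (Suc (Suc n)) - sqrt_iteration v (Suc n))
      \<le> 1/2 * ((r - s) * (r + s))"
    unfolding eq by simp
  also have "\<dots> = sqrt_iteration 1 (Suc (Suc n)) - sqrt_iteration 1 (Suc n)"
    by (simp add: r_def s_def algebra_simps)
  finally show ?case .
qed (use v in simp)

lemma sqrt_iteration_convergent:
  fixes v :: "'a::{real_normed_algebra_1,banach}"
  assumes v: "norm v \<le> 1"
  shows "convergent (sqrt_iteration v)"
proof -
  have "incseq (sqrt_iteration (1::real))" using sqrt_iteration_real by (auto intro: incseq_SucI)
  then obtain L where "sqrt_iteration (1::real) \<longlonglongrightarrow> L"
    using incseq_convergent[of "sqrt_iteration (1::real)" 1] sqrt_iteration_real by blast
  then have "summable (\<lambda>n. sqrt_iteration (1::real) (Suc n) - sqrt_iteration 1 n)"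
    by (rule telescope_summable)
  then have "summable (\<lambda>n. sqrt_iteration v (Suc n) - sqrt_iteration v n)"
    by (rule summable_comparison_test') (rule sqrt_iteration_diff[OF v])
  then have "convergent (\<lambda>n. \<Sum>i<n. sqrt_iteration v (Suc i) - sqrt_iteration v i)"
    by (simp add: summable_iff_convergent)
  then show ?thesis by (simp only: sum_lessThan_telescope) simp
qed

lemma commute_limit:
  fixes X :: "nat \<Rightarrow> 'a::real_normed_algebra"
  assumes "X \<longlonglongrightarrow> l" "\<And>n. X n * c = c * X n"
  shows "l * c = c * l"
proof -
  have "(\<lambda>n. X n * c) \<longlonglongrightarrow> l * c" "(\<lambda>n. c * X n) \<longlonglongrightarrow> c * l"
    by (intro tendsto_intros assms)+
  then show ?thesis using assms(2) LIMSEQ_unique by simp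
qed

text \<open>The limit \<open>w\<close> satisfies \<open>w + w = v + w * w\<close>, that is
  \<open>(1 - w) * (1 - w) = a\<close>, and \<open>1 - w\<close> is positive because
  \<open>norm w \<le> 1\<close>. The commutation clause, inherited from the iterates, serves
  uniqueness.\<close>

lemma cstar_positive_sqrt_contraction:
  fixes a :: "'a::unital_cstar_algebra"
  assumes p: "cstar_positive a" and a: "norm a \<le> 1"
  shows "\<exists>b. cstar_positive b \<and> b * b = a \<and> (\<forall>c. a * c = c * a \<longrightarrow> b * c = c * b)"
proof -
  define v where "v = 1 - a"
  have v: "norm v \<le> 1" using cstar_positive_normD[OF p a] by (simp add: v_def)
  obtain w where w: "sqrt_iteration v \<longlonglongrightarrow> w"
    using sqrt_iteration_convergent[OF v] by (auto simp: convergent_def)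
  have "(\<lambda>n. sqrt_iteration v (Suc n)) \<longlonglongrightarrow> scaleR (1/2) (v + w * w)"
    unfolding sqrt_iteration.simps by (intro tendsto_intros w)
  then have fixpoint: "w = scaleR (1/2) (v + w * w)"
    using w LIMSEQ_Suc LIMSEQ_unique by blast
  then have "w + w = v + w * w" by (metis fixpoint scaleR_half_double scaleR_add_right)
  then have sq: "(1 - w) * (1 - w) = a" by (simp add: v_def algebra_simps)
  have "star v = v" using p by (simp add: v_def star_diff cstar_positive_star)
  then have "star (sqrt_iteration v n) = sqrt_iteration v n" for n
    by (induction n) (simp_all add: star_scaleR star_add star_mult)
  then have "star w = w" using star_limit[OF w] by blast
  moreover have "norm w \<le> 1"
    by (rule LIMSEQ_le_const2[OF tendsto_norm[OF w]])
      (meson order_trans sqrt_iteration_norm[OF v] sqrt_iteration_real)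
  ultimately have "cstar_positive (1 - w)"
    by (intro cstar_positiveI_norm[of _ 1]) (auto simp: star_diff)
  moreover have "(1 - w) * c = c * (1 - w)" if "a * c = c * a" for c
  proof -
    have "v * c = c * v" using that by (simp add: v_def algebra_simps)
    then have "w * c = c * w" using commute_limit[OF w] sqrt_iteration_commute by blast
    then show ?thesis by (simp add: algebra_simps)
  qed
  ultimately show ?thesis using sq by blast
qed

lemma cstar_positive_sqrt_exists:
  fixes a :: "'a::unital_cstar_algebra"
  assumes p: "cstar_positive a"
  shows "\<exists>b. cstar_positive b \<and> b * b = a \<and> (\<forall>c. a * c = c * a \<longrightarrow> b * c = c * b)"
proof (cases "a = 0")
  case True
  then show ?thesis by (intro exI[of _ 0]) auto
next
  case False
  define k where "k = norm a"
  have k: "k > 0" using False by (simp add: k_def)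
  obtain b where b: "cstar_positive b" "b * b = scaleR (1 / k) a"
      "\<And>c. scaleR (1 / k) a * c = c * scaleR (1 / k) a \<Longrightarrow> b * c = c * b"
  proof -
    have "cstar_positive (scaleR (1 / k) a)" using k by (intro cstar_positive_scaleR p) simp
    moreover have "norm (scaleR (1 / k) a) \<le> 1" using k by (simp add: k_def)
    ultimately show ?thesis using cstar_positive_sqrt_contraction that by blast
  qed
  show ?thesis
  proof (intro exI[of _ "scaleR (sqrt k) b"] conjI allI impI)
    show "cstar_positive (scaleR (sqrt k) b)" using b(1) k by (intro cstar_positive_scaleR) auto
    show "scaleR (sqrt k) b * scaleR (sqrt k) b = a" using b(2) k by simp
    show "scaleR (sqrt k) b * c = c * scaleR (sqrt k) b" if "a * c = c * a" for c
      using b(3)[of c] that by simp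
  qed
qed

text \<open>For \<open>d = s - t\<close> one has \<open>d * (s + t) = 0\<close>, so
  \<open>d^2 = 2 d s = - 2 d t\<close>. Since \<open>d^2 s\<close> and \<open>d^2 t\<close> are
  squares of self-adjoint elements, \<open>d^3\<close> and \<open>- d^3\<close> are both positive;
  hence \<open>d^3 = 0\<close>, and the C*-identity applied to \<open>d^4 = 0\<close> gives
  \<open>d = 0\<close>.\<close>

lemma cstar_positive_commuting_sqrt_unique:
  fixes s t :: "'a::unital_cstar_algebra"
  assumes s: "cstar_positive s" and t: "cstar_positive t" and c: "s * t = t * s"
    and eq: "s * s = t * t"
  shows "s = t"
proof -
  define d where "d = s - t"
  have sd: "star d = d" using s t by (simp add: d_def star_diff cstar_positive_star)
  have "d * (s + t) = 0" using c eq by (simp add: d_def algebra_simps)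
  then have st: "d * t = - (d * s)" by (simp add: distrib_left eq_neg_iff_add_eq_0 add.commute)
  have d2: "d * d = scaleR 2 (d * s)" "d * d = scaleR 2 (- (d * t))"
    using st right_diff_distrib[of d s t] by (simp_all add: scaleR_2 flip: d_def)
  have pos: "cstar_positive (d * (d * q))" if q: "cstar_positive q" "q * d = d * q" for q
  proof -
    obtain u where u: "cstar_positive u" "u * u = q" "u * d = d * u"
      using cstar_positive_sqrt_exists[OF q(1)] q(2) by metis
    have "d * (d * q) = (d * u) * (d * u)"
      by (simp only: mult.assoc u(2)[symmetric]) (simp only: mult.assoc[symmetric] u(3))
    then show ?thesis
      using cstar_positive_square[of "d * u"] u sd by (simp add: star_mult cstar_positive_star)
  qed
  have sd': "s * d = d * s" and td: "t * d = d * t" using c by (simp_all add: d_def algebra_simps)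
  have "cstar_positive (scaleR 2 (d * (d * s)))" "cstar_positive (scaleR 2 (d * (d * t)))"
    using pos[OF s sd'] pos[OF t td] by (simp_all add: cstar_positive_scaleR)
  moreover have "d * (d * d) = scaleR 2 (d * (d * s))"
    using arg_cong[OF d2(1), of "(*) d"] by simp
  moreover have "- (d * (d * d)) = scaleR 2 (d * (d * t))"
    using arg_cong[OF d2(2), of "(*) (- d)"] by simp
  ultimately have "d * (d * d) = 0" by (simp only: cstar_positive_antisym)
  then have "(d * d) * (d * d) = 0" by (simp add: mult.assoc)
  moreover have "norm ((d * d) * (d * d)) = (norm (d * d))\<^sup>2"
    by (rule norm_self_adjoint_square) (simp add: star_mult sd)
  ultimately have "d = 0" using norm_self_adjoint_square[OF sd] by simp
  then show ?thesis by (simp add: d_def)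
qed

text \<open>Any root \<open>t\<close> commutes with \<open>a = t^2\<close>, hence with the
  constructed root \<open>b\<close>; uniqueness among commuting roots therefore becomes uniqueness
  outright.\<close>

lemma cstar_sqrt:
  fixes a :: "'a::unital_cstar_algebra"
  assumes "cstar_positive a"
  shows cstar_positive_cstar_sqrt: "cstar_positive (cstar_sqrt a)"
    and cstar_sqrt_power2: "(cstar_sqrt a)\<^sup>2 = a"
proof -
  obtain b where b: "cstar_positive b" "b * b = a" "\<And>c. a * c = c * a \<Longrightarrow> b * c = c * b"
    using cstar_positive_sqrt_exists[OF assms] by blast
  have "t = b" if "cstar_positive t" "t\<^sup>2 = a" for t
  proof -
    have "a * t = t * a" using that(2) by (auto simp: power2_eq_square mult.assoc)
    then show ?thesis
      using cstar_positive_commuting_sqrt_unique[OF b(1) that(1) b(3)] b(2) that(2)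
      by (simp add: power2_eq_square)
  qed
  moreover have "b\<^sup>2 = a" using b(2) by (simp add: power2_eq_square)
  ultimately have "\<exists>!b. cstar_positive b \<and> b\<^sup>2 = a" using b(1) by blast
  from theI'[OF this] show "cstar_positive (cstar_sqrt a)" "(cstar_sqrt a)\<^sup>2 = a"
    unfolding cstar_sqrt_def by blast+
qed

lemma norm_cstar_sqrt:
  fixes a :: "'a::unital_cstar_algebra"
  assumes "cstar_positive a"
  shows "norm (cstar_sqrt a) = sqrt (norm a)"
  using norm_self_adjoint_square[OF cstar_positive_star[OF cstar_positive_cstar_sqrt[OF assms]]]
    cstar_sqrt_power2[OF assms]
  by (metis norm_ge_zero power2_eq_square real_sqrt_unique)

section \<open>Sublinear functionals and strictly positive elements\<close>

text \<open>Homogeneity is asked for as \<open>\<le>\<close>, which is convenient to check for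
  infima; equality follows by scaling back with \<open>inverse r\<close>.\<close>

definition sublinear :: "('v::real_vector \<Rightarrow> real) \<Rightarrow> bool" where
  "sublinear q \<longleftrightarrow> (\<forall>x y. q (x + y) \<le> q x + q y) \<and> (\<forall>r\<ge>0. \<forall>x. q (scaleR r x) \<le> r * q x)"

lemma sublinear_add: "sublinear q \<Longrightarrow> q (x + y) \<le> q x + q y"
  by (simp add: sublinear_def)

lemma sublinear_scaleR:
  assumes q: "sublinear q" and r: "0 \<le> r"
  shows "q (scaleR r x) = r * q x"
proof (cases "r = 0")
  case True
  have "q 0 \<le> 0" using q unfolding sublinear_def by (metis mult_zero_left order_refl scale_zero_left)
  moreover have "q 0 \<le> q 0 + q 0" using sublinear_add[OF q, of 0 0] by simp
  ultimately show ?thesis using True by simp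
next
  case False
  with r have r: "r > 0" by simp
  have "q (scaleR (inverse r) (scaleR r x)) \<le> inverse r * q (scaleR r x)"
    using q r unfolding sublinear_def by (meson inverse_nonnegative_iff_nonnegative less_imp_le)
  then have "r * q x \<le> q (scaleR r x)" using r by (simp add: field_simps)
  moreover have "q (scaleR r x) \<le> r * q x" using q r unfolding sublinear_def by simp
  ultimately show ?thesis by simp
qed

lemma sublinear_ge:
  assumes q: "sublinear q"
  shows "- q (- x) \<le> q x"
  using sublinear_add[OF q, of x "- x"] sublinear_scaleR[OF q, of 0 0] by simp

text \<open>A sublinear functional below \<open>q\<close> (take \<open>t = 0\<close>) whose value at
  \<open>- y\<close> is at most \<open>- q y\<close> (take \<open>t = 1\<close>): a linear
  functional below it must reach \<open>q y\<close> at \<open>y\<close>.\<close>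

definition sublinear_tilt :: "('v::real_vector \<Rightarrow> real) \<Rightarrow> 'v \<Rightarrow> 'v \<Rightarrow> real" where
  "sublinear_tilt q y x = (INF t\<in>{0..}. q (x + scaleR t y) - t * q y)"

lemma sublinear_tilt_le:
  assumes q: "sublinear q" and t: "0 \<le> t"
  shows "sublinear_tilt q y x \<le> q (x + scaleR t y) - t * q y"
  unfolding sublinear_tilt_def
proof (rule cINF_lower)
  \<comment> \<open>Without a lower bound the real infimum would be an unspecified value.\<close>
  have "- q (- x) \<le> q (x + scaleR t y) - t * q y" if "0 \<le> t" for t
    using sublinear_add[OF q, of "- x" "x + scaleR t y"] sublinear_scaleR[OF q that, of y] by simp
  then show "bdd_below ((\<lambda>t. q (x + scaleR t y) - t * q y) ` {0..})"
    by (intro bdd_belowI[of _ "- q (- x)"]) auto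
qed (use t in simp)

lemma sublinear_tilt_greatest:
  "(\<And>t. 0 \<le> t \<Longrightarrow> m \<le> q (x + scaleR t y) - t * q y) \<Longrightarrow> m \<le> sublinear_tilt q y x"
  unfolding sublinear_tilt_def by (rule cINF_greatest) auto

lemma sublinear_sublinear_tilt:
  assumes q: "sublinear q"
  shows "sublinear (sublinear_tilt q y)"
  unfolding sublinear_def
proof (intro conjI allI impI)
  fix x z
  have "sublinear_tilt q y (x + z) - (q (x + scaleR s y) - s * q y) \<le> q (z + scaleR t y) - t * q y"
    if s: "0 \<le> s" and t: "0 \<le> t" for s t
    using sublinear_tilt_le[OF q add_nonneg_nonneg[OF s t], of y "x + z"]
      sublinear_add[OF q, of "x + scaleR s y" "z + scaleR t y"]
    by (simp add: algebra_simps)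
  then have "sublinear_tilt q y (x + z) - (q (x + scaleR s y) - s * q y) \<le> sublinear_tilt q y z"
    if "0 \<le> s" for s
    using that by (blast intro: sublinear_tilt_greatest)
  then have "sublinear_tilt q y (x + z) - sublinear_tilt q y z \<le> q (x + scaleR s y) - s * q y"
    if "0 \<le> s" for s
    using that by (simp add: algebra_simps)
  then have "sublinear_tilt q y (x + z) - sublinear_tilt q y z \<le> sublinear_tilt q y x"
    by (blast intro: sublinear_tilt_greatest)
  then show "sublinear_tilt q y (x + z) \<le> sublinear_tilt q y x + sublinear_tilt q y z" by simp
next
  fix r :: real and x assume r: "0 \<le> r"
  show "sublinear_tilt q y (scaleR r x) \<le> r * sublinear_tilt q y x"
  proof (cases "r = 0")
    case True
    then show ?thesis
      using sublinear_tilt_le[OF q order_refl, of y 0] sublinear_scaleR[OF q order_refl, of 0] by simp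
  next
    case False
    have "sublinear_tilt q y (scaleR r x) / r \<le> q (x + scaleR t y) - t * q y" if t: "0 \<le> t" for t
    proof -
      have "sublinear_tilt q y (scaleR r x) \<le> q (scaleR r (x + scaleR t y)) - r * t * q y"
        using sublinear_tilt_le[OF q mult_nonneg_nonneg[OF r t], of y "scaleR r x"]
        by (simp add: scaleR_add_right)
      also have "\<dots> = r * (q (x + scaleR t y) - t * q y)"
        by (simp only: sublinear_scaleR[OF q r] right_diff_distrib mult.assoc)
      finally show ?thesis using False r by (simp add: field_simps)
    qed
    then have "sublinear_tilt q y (scaleR r x) / r \<le> sublinear_tilt q y x"
      by (rule sublinear_tilt_greatest)
    then show ?thesis using False r by (simp add: field_simps)
  qed
qed

text \<open>Subadditivity compares values of two members \<open>q\<close> and \<open>q'\<close>; in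
  a chain the smaller one bounds both. The common majorant \<open>p\<close> gives the lower bound
  \<open>- p (- x)\<close>.\<close>

lemma sublinear_INF:
  fixes C :: "('v::real_vector \<Rightarrow> real) set"
  assumes C: "C \<noteq> {}" and sub: "\<And>q. q \<in> C \<Longrightarrow> sublinear q"
    and le: "\<And>q. q \<in> C \<Longrightarrow> q \<le> p"
    and chain: "\<And>q q'. q \<in> C \<Longrightarrow> q' \<in> C \<Longrightarrow> q \<le> q' \<or> q' \<le> q"
  shows "sublinear (\<lambda>x. INF q\<in>C. q x)" and "\<And>q x. q \<in> C \<Longrightarrow> (INF q\<in>C. q x) \<le> q x"
proof -
  have "- p (- x) \<le> q x" if "q \<in> C" for q x
    using sublinear_ge[OF sub[OF that], of x] le_funD[OF le[OF that], of "- x"] by linarith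
  then have bdd: "bdd_below ((\<lambda>q. q x) ` C)" for x by (intro bdd_belowI[of _ "- p (- x)"]) auto
  show low: "(INF q\<in>C. q x) \<le> q x" if "q \<in> C" for q x
    using bdd that by (rule cINF_lower)
  show "sublinear (\<lambda>x. INF q\<in>C. q x)"
    unfolding sublinear_def
  proof (intro conjI allI impI)
    fix x y
    have le2: "(INF q\<in>C. q (x + y)) \<le> q x + q' y" if qq: "q \<in> C" "q' \<in> C" for q q'
    proof -
      obtain m where m: "m \<in> C" "m \<le> q" "m \<le> q'" using chain[OF qq] qq by blast
      then show ?thesis
        using low[OF m(1), of "x + y"] sublinear_add[OF sub[OF m(1)], of x y]
          le_funD[OF m(2), of x] le_funD[OF m(3), of y] by linarith
    qed
    have "(INF q\<in>C. q (x + y)) - q x \<le> (INF q\<in>C. q y)" if "q \<in> C" for q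
      using C le2[OF that] by (intro cINF_greatest) (auto simp: algebra_simps)
    then have "(INF q\<in>C. q (x + y)) - (INF q\<in>C. q y) \<le> (INF q\<in>C. q x)"
      using C by (intro cINF_greatest) (auto simp: algebra_simps)
    then show "(INF q\<in>C. q (x + y)) \<le> (INF q\<in>C. q x) + (INF q\<in>C. q y)" by simp
  next
    fix r :: real and x assume r: "0 \<le> r"
    have le2: "(INF q\<in>C. q (scaleR r x)) \<le> r * q x" if "q \<in> C" for q
      using low[OF that, of "scaleR r x"] sublinear_scaleR[OF sub[OF that] r] by simp
    show "(INF q\<in>C. q (scaleR r x)) \<le> r * (INF q\<in>C. q x)"
    proof (cases "r = 0")
      case True
      obtain q where "q \<in> C" using C by blast
      with le2[of q] True show ?thesis by simp
    next
      case False
      have "(INF q\<in>C. q (scaleR r x)) / r \<le> (INF q\<in>C. q x)"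
        using C le2 False r by (intro cINF_greatest) (auto simp: field_simps)
      then show ?thesis using False r by (simp add: field_simps)
    qed
  qed
qed

lemma minimal_sublinear_exists:
  assumes p: "sublinear p"
  shows "\<exists>m. sublinear m \<and> m \<le> p \<and> (\<forall>q. sublinear q \<and> q \<le> m \<longrightarrow> q = m)"
proof -
  define A where "A = {q. sublinear q \<and> q \<le> p}"
  have "\<exists>m\<in>A. \<forall>a\<in>A. a \<le> m \<longrightarrow> a = m"
  proof (rule predicate_Zorn)
    \<comment> \<open>The order is reversed, so that the maximal element provided by Zorn's lemma is
      a minimal functional.\<close>
    show "partial_order_on A (relation_of (\<lambda>f g. g \<le> f) A)"
      by (rule partial_order_on_relation_ofI) auto
    fix C assume "C \<in> Chains (relation_of (\<lambda>f g. g \<le> f) A)"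
    then have CA: "C \<subseteq> A" and chain: "\<And>q q'. q \<in> C \<Longrightarrow> q' \<in> C \<Longrightarrow> q \<le> q' \<or> q' \<le> q"
      by (auto simp: Chains_def relation_of_def)
    show "\<exists>u\<in>A. \<forall>a\<in>C. u \<le> a"
    proof (cases "C = {}")
      case True
      then show ?thesis using p by (auto simp: A_def)
    next
      case False
      have s: "\<And>q. q \<in> C \<Longrightarrow> sublinear q" and l: "\<And>q. q \<in> C \<Longrightarrow> q \<le> p"
        using CA by (auto simp: A_def)
      note inf = sublinear_INF[OF False s l chain]
      define u where "u = (\<lambda>x. INF q\<in>C. q x)"
      have u: "sublinear u" "\<And>q. q \<in> C \<Longrightarrow> u \<le> q"
        using inf unfolding u_def by (auto simp: le_fun_def)
      moreover have "u \<le> p" using False u(2) l order_trans by blast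
      ultimately show ?thesis by (auto simp: A_def)
    qed
  qed
  then show ?thesis unfolding A_def using order_trans by blast
qed

text \<open>A minimal sublinear functional agrees with its tilts, which forces it to be additive.\<close>

lemma sublinear_dominates_linear:
  assumes p: "sublinear p"
  shows "\<exists>f. linear f \<and> (\<forall>x. f x \<le> p x)"
proof -
  obtain m where m: "sublinear m" "m \<le> p" and min: "\<And>q. sublinear q \<Longrightarrow> q \<le> m \<Longrightarrow> q = m"
    using minimal_sublinear_exists[OF p] by blast
  have "sublinear_tilt m y \<le> m" for y
    using sublinear_tilt_le[OF m(1) order_refl, of y] by (simp add: le_fun_def)
  then have tilt: "sublinear_tilt m y = m" for y
    using min sublinear_sublinear_tilt[OF m(1)] by blast
  \<comment> \<open>The parameter \<open>t = 1\<close> in the infimum gives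
    \<open>m x \<le> m (x + y) - m y\<close>, the converse of subadditivity.\<close>
  have add: "m (x + y) = m x + m y" for x y
    using sublinear_tilt_le[OF m(1), of 1 y x] sublinear_add[OF m(1), of x y] by (simp add: tilt)
  have "m 0 = 0" using add[of 0 0] by simp
  then have neg: "m (- x) = - m x" for x using add[of x "- x"] by simp
  have "linear m"
  proof (rule linearI)
    fix r x show "m (scaleR r x) = scaleR r (m x)"
      using sublinear_scaleR[OF m(1), of r x] sublinear_scaleR[OF m(1), of "- r" x] neg[of "scaleR r x"]
      by (cases "0 \<le> r") auto
  qed (rule add)
  with m(2) show ?thesis unfolding le_fun_def by blast
qed

text \<open>A linear functional below the tilt at \<open>y\<close>, rather than merely below
  \<open>p\<close>, satisfies \<open>f (- y) \<le> - p y\<close>, which forces equality at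
  \<open>y\<close>.\<close>

lemma sublinear_supporting_linear:
  assumes p: "sublinear p"
  shows "\<exists>f. linear f \<and> (\<forall>x. f x \<le> p x) \<and> f y = p y"
proof -
  obtain f where f: "linear f" "\<And>x. f x \<le> sublinear_tilt p y x"
    using sublinear_dominates_linear[OF sublinear_sublinear_tilt[OF p]] by blast
  have le: "f x \<le> p x" for x
    using f(2)[of x] sublinear_tilt_le[OF p order_refl, of y x] by simp
  have "f (- y) \<le> - p y"
    using f(2)[of "- y"] sublinear_tilt_le[OF p, of 1 y "- y"] sublinear_scaleR[OF p, of 0 0] by simp
  then have "p y \<le> f y" using linear_neg[OF f(1), of y] by simp
  with le f(1) show ?thesis by (meson antisym)
qed

text \<open>For self-adjoint \<open>a\<close> this is the largest point of the spectrum.\<close>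

definition spectral_gauge :: "'a::unital_cstar_algebra \<Rightarrow> real" where
  "spectral_gauge a = Inf {t. cstar_positive (scaleR (2 * t) 1 - (a + star a))}"

lemma cstar_positive_one: "cstar_positive (1::'a::unital_cstar_algebra)"
  using cstar_positive_square[of "1::'a"] by simp

text \<open>For \<open>s = a + star a\<close> both \<open>2 t - s\<close> and
  \<open>s + norm s\<close> are positive, hence so is their sum, a multiple of \<open>1\<close>; a
  negative multiple would contradict antisymmetry.\<close>

lemma spectral_gauge_bdd:
  fixes a :: "'a::unital_cstar_algebra"
  shows "bdd_below {t. cstar_positive (scaleR (2 * t) 1 - (a + star a))}"
proof (rule bdd_belowI)
  define s where "s = a + star a"
  have s: "star s = s" by (simp add: s_def star_add star_star add.commute)
  fix t assume "t \<in> {t. cstar_positive (scaleR (2 * t) 1 - (a + star a))}"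
  then have "cstar_positive (scaleR (2 * t) 1 - s)" by (simp add: s_def)
  moreover have "cstar_positive (scaleR (norm s) 1 - (- s))"
    by (rule self_adjoint_le_norm) (simp_all add: s)
  ultimately have "cstar_positive ((scaleR (2 * t) 1 - s) + (scaleR (norm s) 1 - (- s)))"
    by (rule cstar_positive_add)
  then have p: "cstar_positive (scaleR (2 * t + norm s) (1::'a))"
    by (simp add: scaleR_add_left)
  show "- norm (a + star a) / 2 \<le> t"
  proof (rule ccontr)
    assume "\<not> ?thesis"
    then have n: "2 * t + norm s < 0" by (simp add: s_def)
    then have "cstar_positive (scaleR (- (2 * t + norm s)) (1::'a))"
      by (intro cstar_positive_scaleR cstar_positive_one) simp
    then have "cstar_positive (- scaleR (2 * t + norm s) (1::'a))"
      by (simp only: scaleR_minus_left)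
    with p have "scaleR (2 * t + norm s) (1::'a) = 0" by (rule cstar_positive_antisym)
    with n show False by simp
  qed
qed

lemma spectral_gauge_le:
  "cstar_positive (scaleR (2 * t) 1 - (a + star a)) \<Longrightarrow> spectral_gauge a \<le> t"
  unfolding spectral_gauge_def by (rule cInf_lower) (simp_all add: spectral_gauge_bdd)

text \<open>The infimum is attained because the cone of positive elements is closed.\<close>

lemma spectral_gauge_positive:
  fixes a :: "'a::unital_cstar_algebra"
  shows "cstar_positive (scaleR (2 * spectral_gauge a) 1 - (a + star a))"
proof -
  let ?S = "{t. cstar_positive (scaleR (2 * t) 1 - (a + star a))}"
  have "star (a + star a) = a + star a" by (simp add: star_add star_star add.commute)
  then have "cstar_positive (scaleR (2 * (norm (a + star a) / 2)) 1 - (a + star a))"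
    by (intro self_adjoint_le_norm) auto
  then have ne: "?S \<noteq> {}" by blast
  have "cstar_positive (scaleR (2 * (spectral_gauge a + inverse (real (Suc n)))) 1 - (a + star a))" for n
  proof -
    have "Inf ?S < spectral_gauge a + inverse (real (Suc n))" by (simp add: spectral_gauge_def)
    then obtain t where t: "t \<in> ?S" "t < spectral_gauge a + inverse (real (Suc n))"
      using cInf_lessD[OF ne] by blast
    let ?d = "2 * (spectral_gauge a + inverse (real (Suc n)) - t)"
    have "cstar_positive ((scaleR (2 * t) 1 - (a + star a)) + scaleR ?d 1)"
      using t by (intro cstar_positive_add cstar_positive_scaleR cstar_positive_one) auto
    moreover have "(scaleR (2 * t) 1 - (a + star a)) + scaleR ?d 1
        = scaleR (2 * t + ?d) 1 - (a + star a)"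
      by (simp only: scaleR_add_left) simp
    moreover have "2 * t + ?d = 2 * (spectral_gauge a + inverse (real (Suc n)))" by simp
    ultimately show ?thesis by (simp only:)
  qed
  moreover have "(\<lambda>n. scaleR (2 * (spectral_gauge a + inverse (real (Suc n)))) 1 - (a + star a))
      \<longlonglongrightarrow> scaleR (2 * (spectral_gauge a + 0)) 1 - (a + star a)"
    by (intro tendsto_intros LIMSEQ_inverse_real_of_nat)
  ultimately show ?thesis using cstar_positive_limit by fastforce
qed

lemma sublinear_spectral_gauge: "sublinear (spectral_gauge :: 'a::unital_cstar_algebra \<Rightarrow> real)"
  unfolding sublinear_def
proof (intro conjI allI impI)
  fix a b :: 'a
  have "cstar_positive ((scaleR (2 * spectral_gauge a) 1 - (a + star a)) +
      (scaleR (2 * spectral_gauge b) 1 - (b + star b)))"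
    by (intro cstar_positive_add spectral_gauge_positive)
  then show "spectral_gauge (a + b) \<le> spectral_gauge a + spectral_gauge b"
    by (intro spectral_gauge_le) (simp add: star_add algebra_simps)
next
  fix r :: real and a :: 'a assume "0 \<le> r"
  then have "cstar_positive (scaleR r (scaleR (2 * spectral_gauge a) 1 - (a + star a)))"
    by (intro cstar_positive_scaleR spectral_gauge_positive)
  then show "spectral_gauge (scaleR r a) \<le> r * spectral_gauge a"
    by (intro spectral_gauge_le) (simp add: star_scaleR algebra_simps)
qed

lemma scaleC_Re_Im:
  "scaleC c a = scaleR (Re c) a + scaleR (Im c) (scaleC \<i> (a::'a::unital_cstar_algebra))"
proof -
  have "scaleC c a = scaleC (of_real (Re c) + of_real (Im c) * \<i>) a"
    by (rule arg_cong[where f="\<lambda>c. scaleC c a"]) (simp add: complex_eq_iff)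
  then show ?thesis by (simp add: scaleC_add_left scaleR_eq_scaleC scaleC_scaleC)
qed

text \<open>This is the usual complexification of a real functional. The gauge sees only
  \<open>a + star a\<close>, so \<open>f\<close> vanishes on skew elements and the form is real on
  self-adjoint ones; for positive \<open>a\<close>,
  \<open>f (- a) \<le> spectral_gauge (- a) \<le> 0\<close>.\<close>

lemma positive_form_of_gauge_bounded:
  fixes f :: "'a::unital_cstar_algebra \<Rightarrow> real"
  assumes f: "linear f" and le: "\<And>a. f a \<le> spectral_gauge a"
  shows "positive_form (\<lambda>a. Complex (f a) (- f (scaleC \<i> a)))"
proof -
  have skew: "f a = 0" if "star a = - a" for a
  proof -
    have "spectral_gauge a \<le> 0" "spectral_gauge (- a) \<le> 0"
      using that by (intro spectral_gauge_le; simp)+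
    with le[of a] le[of "- a"] show ?thesis by (simp add: linear_neg[OF f])
  qed
  have ii: "scaleC \<i> (scaleC \<i> a) = - a" for a :: 'a by (simp add: scaleC_scaleC)
  show ?thesis
    unfolding positive_form_def
  proof (intro conjI allI impI)
    fix c and a :: 'a
    have "f (scaleC c a) = Re c * f a + Im c * f (scaleC \<i> a)"
      by (simp add: scaleC_Re_Im[of c a] linear_add[OF f] linear_cmul[OF f])
    moreover have "scaleC \<i> (scaleC c a) = scaleC c (scaleC \<i> a)"
      by (simp add: scaleC_scaleC mult.commute)
    then have "f (scaleC \<i> (scaleC c a)) = Re c * f (scaleC \<i> a) - Im c * f a"
      by (simp add: scaleC_Re_Im[of c "scaleC \<i> a"] ii linear_add[OF f] linear_cmul[OF f] linear_diff[OF f])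
    ultimately show "Complex (f (scaleC c a)) (- f (scaleC \<i> (scaleC c a)))
        = c * Complex (f a) (- f (scaleC \<i> a))"
      by (simp add: complex_eq_iff algebra_simps)
  next
    fix a :: 'a assume a: "cstar_positive a"
    have "spectral_gauge (- a) \<le> 0"
      using a cstar_positive_add[OF a a] by (intro spectral_gauge_le) (simp add: cstar_positive_star)
    with le[of "- a"] have "0 \<le> f a" by (simp add: linear_neg[OF f])
    moreover have "f (scaleC \<i> a) = 0"
      using a by (intro skew) (simp add: star_scaleC cstar_positive_star)
    ultimately show "Complex (f a) (- f (scaleC \<i> a)) \<in> complex_of_real ` {0..}"
      by (auto simp: complex_eq_iff image_iff)
  qed (simp add: linear_add[OF f] scaleC_add_right complex_eq_iff)
qed

text \<open>Every form obtained from the gauge is real at \<open>w\<close>, so each such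
  \<open>f\<close> vanishes at \<open>b = \<i> w\<close>. Functionals supporting the gauge at
  \<open>b\<close> and at \<open>- b\<close> show that it is \<open>0\<close> at both, so
  \<open>b + star b\<close> and its negative are positive; thus \<open>b\<close> is skew and
  \<open>w\<close> self-adjoint.\<close>

lemma strictly_positive_self_adjoint:
  fixes w :: "'a::unital_cstar_algebra"
  assumes w: "strictly_positive w"
  shows "star w = w"
proof -
  have zero: "f (scaleC \<i> w) = 0" if f: "linear f" "\<And>a. f a \<le> spectral_gauge a" for f
  proof -
    define \<phi> where "\<phi> = (\<lambda>a. Complex (f a) (- f (scaleC \<i> a)))"
    have "positive_form \<phi>" unfolding \<phi>_def by (rule positive_form_of_gauge_bounded[OF f])
    then have "\<phi> w = 0 \<or> \<phi> w \<in> complex_of_real ` {0<..}"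
      using w unfolding strictly_positive_def by blast
    then have "Im (\<phi> w) = 0" by auto
    then show ?thesis by (simp add: \<phi>_def)
  qed
  define b where "b = scaleC \<i> w"
  obtain f where f: "linear f" "\<And>a. f a \<le> spectral_gauge a" "f b = spectral_gauge b"
    using sublinear_supporting_linear[OF sublinear_spectral_gauge] by metis
  then have "spectral_gauge b = 0" using zero[OF f(1,2)] by (simp add: b_def)
  moreover obtain g where g: "linear g" "\<And>a. g a \<le> spectral_gauge a" "g (- b) = spectral_gauge (- b)"
    using sublinear_supporting_linear[OF sublinear_spectral_gauge] by metis
  then have "spectral_gauge (- b) = 0" using zero[OF g(1,2)] by (simp add: b_def linear_neg[OF g(1)])
  ultimately have "cstar_positive (- (b + star b))" "cstar_positive (b + star b)"
    using spectral_gauge_positive[of b] spectral_gauge_positive[of "- b"]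
    by (simp_all add: add.commute)
  then have "b + star b = 0" using cstar_positive_antisym by blast
  then have "scaleC \<i> (w - star w) = 0" by (simp add: b_def star_scaleC scaleC_diff_right)
  then have "scaleC (- \<i>) (scaleC \<i> (w - star w)) = 0" by simp
  then show ?thesis by (simp add: scaleC_scaleC del: scaleC_minus_left)
qed

section \<open>Hilbert modules\<close>

text \<open>\<open>w^2 - 16 a b\<close> is the discriminant of \<open>2 a t^2 - w t + 2 b\<close>,
  whose minimum is at \<open>t = w / (4 a)\<close>. As only positive \<open>t\<close> are allowed,
  \<open>w = 0\<close> and \<open>a = 0\<close> are treated apart.\<close>

lemma discriminant_bound:
  fixes w a b :: real
  assumes w: "0 \<le> w" and a: "0 \<le> a" and t: "\<And>t. 0 < t \<Longrightarrow> t * w \<le> 2 * (t\<^sup>2 * a + b)"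
  shows "w\<^sup>2 \<le> 16 * a * b"
proof (cases "w = 0")
  case True
  have "0 \<le> a * b"
  proof (cases "a = 0")
    case False
    with a have a: "a > 0" by simp
    show ?thesis
    proof (rule ccontr)
      assume "\<not> ?thesis"
      with a have b: "b < 0" by (simp add: zero_le_mult_iff)
      have "(sqrt (- b / (2 * a)))\<^sup>2 = - b / (2 * a)" using a b by (simp add: field_simps)
      with t[of "sqrt (- b / (2 * a))"] True a b show False by (simp add: field_simps)
    qed
  qed simp
  with True show ?thesis by simp
next
  case False
  with w have w: "w > 0" by simp
  show ?thesis
  proof (cases "a = 0")
    case True
    with t[of "(2 * \<bar>b\<bar> + 1) / w"] w show ?thesis by simp
  next
    case False
    with a have a: "a > 0" by simp
    have "w / (4 * a) * w \<le> 2 * ((w / (4 * a))\<^sup>2 * a + b)" using w a by (intro t) simp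
    then show ?thesis using a by (simp add: field_simps power2_eq_square)
  qed
qed

text \<open>Partial sums beyond \<open>k\<close> contain \<open>F\<close>, so they exceed
  \<open>sum f F\<close> by positive terms; the cone is closed.\<close>

lemma sum_le_suminf_cstar:
  fixes f :: "nat \<Rightarrow> 'a::unital_cstar_algebra"
  assumes f: "summable f" and p: "\<And>n. cstar_positive (f n)" and F: "finite F"
  shows "sum f F \<preceq> suminf f"
proof -
  obtain k where k: "F \<subseteq> {..<k}" using F finite_nat_iff_bounded by blast
  have "(\<lambda>N. sum f {..<N + k} - sum f F) \<longlonglongrightarrow> suminf f - sum f F"
    by (intro tendsto_intros LIMSEQ_ignore_initial_segment summable_LIMSEQ f)
  moreover have "cstar_positive (sum f {..<N + k} - sum f F)" for N
  proof -
    have "F \<subseteq> {..<N + k}" using k by auto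
    then have "sum f {..<N + k} - sum f F = sum f ({..<N + k} - F)"
      using F by (simp add: sum_diff)
    then show ?thesis using p cstar_positive_sum by metis
  qed
  ultimately show ?thesis unfolding cstar_le_def by (rule cstar_positive_limit)
qed

lemma suminf_cstar_positive:
  fixes f :: "nat \<Rightarrow> 'a::unital_cstar_algebra"
  assumes "summable f" "\<And>n. cstar_positive (f n)"
  shows "cstar_positive (suminf f)"
  using sum_le_suminf_cstar[OF assms, of "{}"] by (simp add: cstar_le_def)

context hilbert_module
begin

lemma diff_closed: "x \<in> mcarrier H \<Longrightarrow> y \<in> mcarrier H \<Longrightarrow> x - y \<in> mcarrier H"
  using add_closed[of x "- y"] uminus_closed by simp

lemma sum_closed: "(\<And>i. i \<in> F \<Longrightarrow> f i \<in> mcarrier H) \<Longrightarrow> sum f F \<in> mcarrier H"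
  by (induction F rule: infinite_finite_induct) (auto simp: zero_closed add_closed)

lemma act_zero_left: "x \<in> mcarrier H \<Longrightarrow> act H 0 x = 0"
  using act_add_left[of x 0 0] by simp

lemma act_minus_one: "x \<in> mcarrier H \<Longrightarrow> act H (- 1) x = - x"
  using act_add_left[of x "- 1" 1] by (simp add: act_zero_left act_one eq_neg_iff_add_eq_0)

lemma ip_add_right:
  "\<lbrakk>x \<in> mcarrier H; y \<in> mcarrier H; z \<in> mcarrier H\<rbrakk> \<Longrightarrow> ip H z (x + y) = ip H z x + ip H z y"
  using ip_star[of "x + y" z] by (simp add: add_closed ip_add star_add) (simp add: ip_star)

lemma ip_act_right:
  "\<lbrakk>x \<in> mcarrier H; y \<in> mcarrier H\<rbrakk> \<Longrightarrow> ip H x (act H a y) = ip H x y * star a"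
  using ip_star[of "act H a y" x] by (simp add: act_closed ip_act star_mult) (simp add: ip_star)

lemma ip_zero_left: "y \<in> mcarrier H \<Longrightarrow> ip H 0 y = 0"
  using ip_add[of 0 0 y] zero_closed by simp

lemma ip_zero_right: "y \<in> mcarrier H \<Longrightarrow> ip H y 0 = 0"
  using ip_add_right[of 0 0 y] zero_closed by simp

lemma ip_minus_left: "\<lbrakk>x \<in> mcarrier H; y \<in> mcarrier H\<rbrakk> \<Longrightarrow> ip H (- x) y = - ip H x y"
  using ip_add[of x "- x" y] by (simp add: uminus_closed ip_zero_left eq_neg_iff_add_eq_0 add.commute)

lemma ip_minus_right: "\<lbrakk>x \<in> mcarrier H; y \<in> mcarrier H\<rbrakk> \<Longrightarrow> ip H y (- x) = - ip H y x"
  using ip_add_right[of x "- x" y]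
  by (simp add: uminus_closed ip_zero_right eq_neg_iff_add_eq_0 add.commute)

lemma ip_diff_right:
  "\<lbrakk>x \<in> mcarrier H; y \<in> mcarrier H; z \<in> mcarrier H\<rbrakk> \<Longrightarrow> ip H z (x - y) = ip H z x - ip H z y"
  using ip_add_right[of x "- y" z] by (simp add: uminus_closed ip_minus_right)

lemma ip_sum_left:
  "\<lbrakk>\<And>i. i \<in> F \<Longrightarrow> f i \<in> mcarrier H; y \<in> mcarrier H\<rbrakk> \<Longrightarrow> ip H (sum f F) y = (\<Sum>i\<in>F. ip H (f i) y)"
  by (induction F rule: infinite_finite_induct) (auto simp: ip_zero_left ip_add sum_closed)

lemma ip_sum_right:
  "\<lbrakk>\<And>i. i \<in> F \<Longrightarrow> f i \<in> mcarrier H; y \<in> mcarrier H\<rbrakk> \<Longrightarrow> ip H y (sum f F) = (\<Sum>i\<in>F. ip H y (f i))"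
  by (induction F rule: infinite_finite_induct) (auto simp: ip_zero_right ip_add_right sum_closed)

lemma habs_power2: "x \<in> mcarrier H \<Longrightarrow> (habs H x)\<^sup>2 = ip H x x"
  unfolding habs_def by (intro cstar_sqrt_power2 ip_positive)

lemma hnorm_eq: "x \<in> mcarrier H \<Longrightarrow> hnorm H x = sqrt (norm (ip H x x))"
  unfolding hnorm_def habs_def by (intro norm_cstar_sqrt ip_positive)

lemma hnorm_uminus: "x \<in> mcarrier H \<Longrightarrow> hnorm H (- x) = hnorm H x"
  by (simp add: hnorm_eq uminus_closed ip_minus_left ip_minus_right)

lemma norm_ip_act_le:
  assumes x: "x \<in> mcarrier H"
  shows "norm (ip H (act H a x) (act H a x)) \<le> (norm a)\<^sup>2 * norm (ip H x x)"
proof -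
  have "ip H (act H a x) (act H a x) = a * (ip H x x * star a)"
    by (simp add: x act_closed ip_act ip_act_right mult.assoc)
  also have "norm \<dots> \<le> norm a * (norm (ip H x x) * norm (star a))"
    by (meson mult_left_mono norm_ge_zero norm_mult_ineq order_trans)
  finally show ?thesis by (simp add: power2_eq_square mult_ac)
qed

text \<open>
  By the parallelogram law \<open>\<langle>y \<plusminus> c z, y \<plusminus> c z\<rangle> \<preceq> 2 \<langle>y, y\<rangle> + 2 \<langle>z, z\<rangle>\<close> for \<open>\<bar>c\<bar> = 1\<close>; polarisation with
  \<open>c = 1\<close> and \<open>c = \<i>\<close> then bounds \<open>\<langle>y, z\<rangle>\<close>. The constant is not optimal, but no order inequality
  \<open>a b a\<^sup>* \<preceq> \<parallel>b\<parallel> a a\<^sup>*\<close> is needed.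
\<close>

lemma norm_ip_sum_le:
  assumes y: "\<And>i. i \<in> F \<Longrightarrow> y i \<in> mcarrier H" and z: "\<And>i. i \<in> F \<Longrightarrow> z i \<in> mcarrier H"
  shows "norm (\<Sum>i\<in>F. ip H (y i) (z i))
    \<le> 2 * (norm (\<Sum>i\<in>F. ip H (y i) (y i)) + norm (\<Sum>i\<in>F. ip H (z i) (z i)))"
proof -
  define Y where "Y = (\<Sum>i\<in>F. ip H (y i) (y i))"
  define Z where "Z = (\<Sum>i\<in>F. ip H (z i) (z i))"
  define W where "W = (\<Sum>i\<in>F. ip H (y i) (z i))"
  define V where "V c = scaleC (cnj c) W + scaleC c (star W)" for c
  have W': "star W = (\<Sum>i\<in>F. ip H (z i) (y i))"
    unfolding W_def star_sum by (intro sum.cong refl ip_star y z)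
  have scaleC_sum: "scaleC c (sum f F) = (\<Sum>i\<in>F. scaleC c (f i))" for c and f :: "_ \<Rightarrow> 'a"
    by (induction F rule: infinite_finite_induct) (auto simp: scaleC_add_right)
  have pos: "cstar_positive (Y + Z + V c)" if c: "c * cnj c = 1" for c
  proof -
    define u where "u i = act H (scaleC c 1) (z i)" for i
    have u: "u i \<in> mcarrier H" if "i \<in> F" for i using z[OF that] by (simp add: u_def act_closed)
    have "ip H (y i + u i) (y i + u i) = ip H (y i) (y i) + ip H (z i) (z i)
        + (scaleC (cnj c) (ip H (y i) (z i)) + scaleC c (ip H (z i) (y i)))" if i: "i \<in> F" for i
    proof -
      have "ip H (y i + u i) (y i + u i)
          = (ip H (y i) (y i) + ip H (y i) (u i)) + (ip H (u i) (y i) + ip H (u i) (u i))"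
        using y[OF i] u[OF i] by (simp add: ip_add ip_add_right add_closed)
      moreover have "ip H (y i) (u i) = scaleC (cnj c) (ip H (y i) (z i))"
        using y[OF i] z[OF i] by (simp add: u_def ip_act_right star_scaleC mult_scaleC_right)
      moreover have "ip H (u i) (y i) = scaleC c (ip H (z i) (y i))"
        using y[OF i] z[OF i] by (simp add: u_def ip_act mult_scaleC_left)
      moreover have "ip H (u i) (u i) = ip H (z i) (z i)"
        using z[OF i] c mult.commute[of c] by (simp add: u_def ip_act ip_act_right act_closed star_scaleC
          mult_scaleC_left mult_scaleC_right scaleC_scaleC)
      ultimately show ?thesis by (simp add: add_ac)
    qed
    then have "(\<Sum>i\<in>F. ip H (y i + u i) (y i + u i)) = Y + Z + V c"
      unfolding V_def W' by (simp add: Y_def Z_def W_def sum.distrib scaleC_sum)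
    moreover have "cstar_positive (\<Sum>i\<in>F. ip H (y i + u i) (y i + u i))"
      by (intro cstar_positive_sum ip_positive add_closed y u)
    ultimately show ?thesis by simp
  qed
  have V: "norm (V c) \<le> 2 * (norm Y + norm Z)" if c: "c * cnj c = 1" for c
  proof -
    have neg: "V (- c) = - V c" by (simp add: V_def)
    have p: "cstar_positive (Y + Z + V c)" "cstar_positive (Y + Z - V c)"
      using pos[OF c] pos[of "- c"] c by (simp_all add: neg)
    have e: "scaleR 2 (Y + Z) - (Y + Z + V c) = Y + Z - V c"
        "scaleR 2 (Y + Z) - (Y + Z - V c) = Y + Z + V c"
      by (simp_all add: scaleR_2)
    have "norm (Y + Z + V c) \<le> norm (scaleR 2 (Y + Z))"
        "norm (Y + Z - V c) \<le> norm (scaleR 2 (Y + Z))"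
      using p cstar_norm_mono[of "Y + Z + V c" "scaleR 2 (Y + Z)"]
        cstar_norm_mono[of "Y + Z - V c" "scaleR 2 (Y + Z)"]
      unfolding cstar_le_def e by blast+
    moreover have "norm (scaleR 2 (Y + Z)) \<le> 2 * (norm Y + norm Z)"
      using norm_triangle_ineq[of Y Z] by simp
    moreover have "norm (scaleR 2 (V c)) \<le> norm (Y + Z + V c) + norm (Y + Z - V c)"
      using norm_triangle_ineq4[of "Y + Z + V c" "Y + Z - V c"] by (simp add: scaleR_2)
    ultimately show ?thesis by simp
  qed
  \<comment> \<open>\<open>V 1 = W + star W\<close>, and multiplying \<open>V \<i>\<close> by
    \<open>\<i>\<close> yields \<open>W - star W\<close>.\<close>
  have "scaleR 2 W = V 1 + scaleC \<i> (V \<i>)"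
    by (simp add: V_def scaleC_diff_right scaleC_scaleC scaleR_2)
  then have "norm (scaleR 2 W) \<le> norm (V 1) + norm (scaleC \<i> (V \<i>))"
    by (simp add: norm_triangle_ineq)
  then have "norm W \<le> 2 * (norm Y + norm Z)"
    using V[of 1] V[of \<i>] by (simp add: norm_scaleC)
  then show ?thesis by (simp only: W_def Y_def Z_def)
qed

text \<open>Scaling \<open>y\<close> by \<open>t\<close> turns the additive bound into a quadratic
  in \<open>t\<close>. The form for finite families applies to truncated elements of
  \<open>l2_module H\<close> while working in \<open>H\<close> alone.\<close>

lemma ip_sum_cauchy_schwarz:
  assumes y: "\<And>i. i \<in> F \<Longrightarrow> y i \<in> mcarrier H" and z: "\<And>i. i \<in> F \<Longrightarrow> z i \<in> mcarrier H"
  shows "(norm (\<Sum>i\<in>F. ip H (y i) (z i)))\<^sup>2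
    \<le> 16 * norm (\<Sum>i\<in>F. ip H (y i) (y i)) * norm (\<Sum>i\<in>F. ip H (z i) (z i))"
proof (rule discriminant_bound)
  fix t :: real assume t: "0 < t"
  define u where "u i = act H (scaleR t 1) (y i)" for i
  have u: "\<And>i. i \<in> F \<Longrightarrow> u i \<in> mcarrier H" by (simp add: u_def act_closed y)
  have "(\<Sum>i\<in>F. ip H (u i) (z i)) = scaleR t (\<Sum>i\<in>F. ip H (y i) (z i))"
    by (simp add: u_def ip_act y z scaleR_sum_right)
  moreover have "(\<Sum>i\<in>F. ip H (u i) (u i)) = scaleR (t\<^sup>2) (\<Sum>i\<in>F. ip H (y i) (y i))"
    by (simp add: u_def ip_act ip_act_right act_closed y star_scaleR scaleR_sum_right power2_eq_square)
  ultimately show "t * norm (\<Sum>i\<in>F. ip H (y i) (z i))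
      \<le> 2 * (t\<^sup>2 * norm (\<Sum>i\<in>F. ip H (y i) (y i)) + norm (\<Sum>i\<in>F. ip H (z i) (z i)))"
    using norm_ip_sum_le[of F u z] u z t by simp
qed simp_all

lemma norm_ip_le:
  assumes "x \<in> mcarrier H" "y \<in> mcarrier H"
  shows "norm (ip H x y) \<le> 4 * hnorm H x * hnorm H y"
proof -
  have "(norm (ip H x y))\<^sup>2 \<le> 16 * norm (ip H x x) * norm (ip H y y)"
    using ip_sum_cauchy_schwarz[of "{()}" "\<lambda>_. x" "\<lambda>_. y"] assms by simp
  also have "\<dots> = (4 * hnorm H x * hnorm H y)\<^sup>2"
    by (simp add: hnorm_eq assms power_mult_distrib)
  finally show ?thesis
    by (rule power2_le_imp_le) (simp add: hnorm_eq assms)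
qed

lemma tendsto_ip_right:
  assumes X: "\<And>n. X n \<in> mcarrier H" and lim: "htendsto H X l" and u: "u \<in> mcarrier H"
  shows "(\<lambda>n. ip H u (X n)) \<longlonglongrightarrow> ip H u l"
proof -
  have l: "l \<in> mcarrier H" and h: "(\<lambda>n. hnorm H (X n - l)) \<longlonglongrightarrow> 0"
    using lim by (auto simp: htendsto_def)
  have "norm (ip H u (X n) - ip H u l) \<le> 4 * hnorm H u * hnorm H (X n - l)" for n
    using norm_ip_le[OF u diff_closed[OF X l]] by (simp add: ip_diff_right X l u)
  then have "(\<lambda>n. ip H u (X n) - ip H u l) \<longlonglongrightarrow> 0"
    by (intro Lim_null_comparison[OF always_eventually tendsto_mult_right_zero[OF h]] allI)
  then show ?thesis by (simp add: LIM_zero_iff)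
qed

section \<open>Orthogonal projections\<close>

lemma orth_compl_add:
  "\<lbrakk>K \<subseteq> mcarrier H; x \<in> orth_compl H K; y \<in> orth_compl H K\<rbrakk> \<Longrightarrow> x + y \<in> orth_compl H K"
  unfolding orth_compl_def by (auto simp: add_closed ip_add subset_iff)

lemma orth_compl_act:
  "\<lbrakk>K \<subseteq> mcarrier H; x \<in> orth_compl H K\<rbrakk> \<Longrightarrow> act H a x \<in> orth_compl H K"
  unfolding orth_compl_def by (auto simp: act_closed ip_act subset_iff)

context
  fixes K
  assumes K: "orthogonally_complemented H K"
begin

lemma complemented_closed: "closed_submodule H K"
  using K unfolding orthogonally_complemented_def by (rule conjunct1)

lemma complemented_Int: "K \<inter> orth_compl H K = {0}"
  using K unfolding orthogonally_complemented_def by (elim conjE)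

lemma complemented_subset: "K \<subseteq> mcarrier H"
  using complemented_closed unfolding closed_submodule_def by (elim conjE) blast

lemma complemented_add: "x \<in> K \<Longrightarrow> y \<in> K \<Longrightarrow> x + y \<in> K"
  using complemented_closed unfolding closed_submodule_def by (elim conjE) blast

lemma complemented_act: "x \<in> K \<Longrightarrow> act H a x \<in> K"
  using complemented_closed unfolding closed_submodule_def by (elim conjE) blast

lemma orth_proj_eqI:
  assumes y: "y \<in> K" and z: "z \<in> orth_compl H K" and x: "x = y + z"
  shows "orth_proj H K x = y"
  unfolding orth_proj_def
proof (rule the_equality)
  show "y \<in> K \<and> (\<exists>z\<in>orth_compl H K. x = y + z)" using y z x by blast
next
  fix y' assume "y' \<in> K \<and> (\<exists>z\<in>orth_compl H K. x = y' + z)"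
  then obtain z' where y': "y' \<in> K" and z': "z' \<in> orth_compl H K" and x': "x = y' + z'" by blast
  have c: "y \<in> mcarrier H" "z' \<in> mcarrier H"
    using y z' complemented_subset by (auto simp: orth_compl_def)
  \<comment> \<open>Submodules are given by sums and the action, so negatives are written as the
    action of \<open>- 1\<close>.\<close>
  have "y' + act H (- 1) y \<in> K" by (intro complemented_add complemented_act y y')
  moreover have "z + act H (- 1) z' \<in> orth_compl H K"
    by (intro orth_compl_add orth_compl_act complemented_subset z z')
  moreover have "y' - y = z - z'" using x x' by (simp add: algebra_simps)
  ultimately have "y' - y \<in> K \<inter> orth_compl H K"
    by (simp add: act_minus_one c)
  then show "y' = y" by (simp add: complemented_Int)
qed

lemma orth_proj_decomposition:
  assumes "x \<in> mcarrier H"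
  obtains z where "orth_proj H K x \<in> K" "z \<in> orth_compl H K" "x = orth_proj H K x + z"
proof -
  have "x \<in> {y + z | y z. y \<in> K \<and> z \<in> orth_compl H K}"
    using assms K unfolding orthogonally_complemented_def by blast
  then obtain y z where yz: "y \<in> K" "z \<in> orth_compl H K" "x = y + z" by blast
  with orth_proj_eqI[OF yz] that show ?thesis by simp
qed

lemma orth_proj_closed: "x \<in> mcarrier H \<Longrightarrow> orth_proj H K x \<in> mcarrier H"
  using orth_proj_decomposition complemented_subset by blast

lemma orth_proj_add:
  assumes "x \<in> mcarrier H" "y \<in> mcarrier H"
  shows "orth_proj H K (x + y) = orth_proj H K x + orth_proj H K y"
proof -
  obtain z where z: "orth_proj H K x \<in> K" "z \<in> orth_compl H K" "x = orth_proj H K x + z"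
    using assms(1) by (rule orth_proj_decomposition)
  obtain w where w: "orth_proj H K y \<in> K" "w \<in> orth_compl H K" "y = orth_proj H K y + w"
    using assms(2) by (rule orth_proj_decomposition)
  have eq: "x + y = (orth_proj H K x + orth_proj H K y) + (z + w)"
    by (subst z(3), subst w(3)) (simp only: add_ac)
  show ?thesis
    using complemented_add[OF z(1) w(1)] orth_compl_add[OF complemented_subset z(2) w(2)] eq
    by (rule orth_proj_eqI)
qed

lemma orth_proj_act:
  assumes "x \<in> mcarrier H"
  shows "orth_proj H K (act H a x) = act H a (orth_proj H K x)"
proof -
  obtain z where z: "orth_proj H K x \<in> K" "z \<in> orth_compl H K" "x = orth_proj H K x + z"
    using assms by (rule orth_proj_decomposition)
  have eq: "act H a x = act H a (orth_proj H K x) + act H a z"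
    using z(2) orth_proj_closed[OF assms] by (subst z(3)) (simp add: act_add_right orth_compl_def)
  show ?thesis
    using complemented_act[OF z(1)] orth_compl_act[OF complemented_subset z(2)] eq
    by (rule orth_proj_eqI)
qed

lemma orth_proj_self_adjoint:
  assumes x: "x \<in> mcarrier H" and y: "y \<in> mcarrier H"
  shows "ip H (orth_proj H K x) y = ip H x (orth_proj H K y)"
proof -
  obtain z where z: "orth_proj H K x \<in> K" "z \<in> orth_compl H K" "x = orth_proj H K x + z"
    using x by (rule orth_proj_decomposition)
  obtain w where w: "orth_proj H K y \<in> K" "w \<in> orth_compl H K" "y = orth_proj H K y + w"
    using y by (rule orth_proj_decomposition)
  define p where "p = orth_proj H K x"
  define q where "q = orth_proj H K y"
  have c: "p \<in> mcarrier H" "q \<in> mcarrier H" "z \<in> mcarrier H" "w \<in> mcarrier H"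
    using z(2) w(2) orth_proj_closed x y by (auto simp: orth_compl_def p_def q_def)
  have zq: "ip H z q = 0" and wp: "ip H w p = 0"
    using z w by (auto simp: orth_compl_def p_def q_def)
  have pw: "ip H p w = 0" using ip_star[OF c(4,1)] wp by simp
  have xy: "x = p + z" "y = q + w" using z(3) w(3) by (simp_all only: p_def q_def)
  have "ip H p (q + w) = ip H (p + z) q"
    by (simp add: ip_add ip_add_right c pw zq)
  then have "ip H p y = ip H x q" by (simp only: xy[symmetric])
  then show ?thesis by (simp only: p_def q_def)
qed

end

end


section \<open>Frame transforms\<close>

lemma (in hilbert_module) hnorm_l2_module:
  assumes y: "y \<in> mcarrier (l2_module H)"
  shows "hnorm (l2_module H) y = sqrt (norm (\<Sum>n. ip H (y n) (y n)))"
proof -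
  have "cstar_positive (\<Sum>n. ip H (y n) (y n))"
    using y by (intro suminf_cstar_positive ip_positive) (auto simp: l2_module_def)
  then show ?thesis by (simp add: hnorm_def habs_def l2_module_def norm_cstar_sqrt)
qed

text \<open>Two adjoints are compared by pairing with \<open>u = S v - S' v\<close>, so definiteness
  is used in \<open>H\<close> alone and \<open>K\<close> may be an arbitrary
  \<open>cmodule\<close>.\<close>

lemma (in hilbert_module) is_adjoint_eq_adjoint_op:
  assumes S: "is_adjoint H K T S" and v: "v \<in> mcarrier K"
  shows "adjoint_op H K T v = S v"
proof -
  have uniq: "S v = S' v" if S': "is_adjoint H K T S'" and v: "v \<in> mcarrier K" for S' v
  proof -
    have c: "S v \<in> mcarrier H" "S' v \<in> mcarrier H"
      using S S' v by (auto simp: is_adjoint_def)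
    have "ip H u (S v) = ip H u (S' v)" if "u \<in> mcarrier H" for u
      using S S' v that unfolding is_adjoint_def by metis
    then have "ip H (S v - S' v) (S v - S' v) = 0"
      using c by (simp add: ip_diff_right diff_closed)
    then show ?thesis using ip_definite[OF diff_closed[OF c]] by simp
  qed
  have "adjoint_op H K T = restrict S (mcarrier K)"
    unfolding adjoint_op_def
  proof (rule the_equality)
    show "is_adjoint H K T (restrict S (mcarrier K)) \<and> restrict S (mcarrier K) \<in> extensional (mcarrier K)"
      using S by (auto simp: is_adjoint_def)
    show "S' = restrict S (mcarrier K)"
      if "is_adjoint H K T S' \<and> S' \<in> extensional (mcarrier K)" for S'
      using that uniq by (intro extensionalityI[of _ "mcarrier K"]) auto
  qed
  with v show ?thesis by simp
qed

locale fusion_frame = hilbert_module H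
  for H :: "('a::unital_cstar_algebra, 'h::ab_group_add) cmodule" +
  fixes K :: "nat \<Rightarrow> 'h set" and \<omega> :: "nat \<Rightarrow> 'a"
  assumes frame: "star_fusion_frame H K \<omega>"
begin

lemma complemented: "orthogonally_complemented H (K n)"
  using frame unfolding star_fusion_frame_def by blast

lemma weight_commute: "\<omega> n * a = a * \<omega> n"
  using frame unfolding star_fusion_frame_def cstar_weight_def by blast

lemma weight_star: "star (\<omega> n) = \<omega> n"
  using frame strictly_positive_self_adjoint
  unfolding star_fusion_frame_def cstar_weight_def by blast

abbreviation transform :: "'h \<Rightarrow> nat \<Rightarrow> 'h" where
  "transform \<equiv> frame_transform H K \<omega>"

lemma transform_closed: "x \<in> mcarrier H \<Longrightarrow> transform x n \<in> mcarrier H"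
  by (simp add: frame_transform_def act_closed orth_proj_closed complemented)

lemma transform_add:
  "\<lbrakk>x \<in> mcarrier H; y \<in> mcarrier H\<rbrakk> \<Longrightarrow> transform (x + y) n = transform x n + transform y n"
  by (simp add: frame_transform_def orth_proj_add[OF complemented] orth_proj_closed complemented
    act_add_right)

lemma transform_act: "x \<in> mcarrier H \<Longrightarrow> transform (act H a x) n = act H a (transform x n)"
  by (simp add: frame_transform_def orth_proj_act[OF complemented] orth_proj_closed complemented
    act_act weight_commute)

text \<open>Here the weights must be self-adjoint and central: the action leaves the second argument
  as \<open>star (\<omega> n)\<close> on the right, whereas the first argument yields
  \<open>\<omega> n\<close> on the left.\<close>

lemma transform_self_adjoint:
  assumes x: "x \<in> mcarrier H" and y: "y \<in> mcarrier H"
  shows "ip H (transform x n) y = ip H x (transform y n)"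
proof -
  have "ip H (transform x n) y = ip H x (orth_proj H (K n) y) * \<omega> n"
    using x y by (simp add: frame_transform_def ip_act orth_proj_closed complemented
      orth_proj_self_adjoint[OF complemented] weight_commute)
  also have "\<dots> = ip H x (transform y n)"
    using x y by (simp add: frame_transform_def ip_act_right orth_proj_closed complemented weight_star)
  finally show ?thesis .
qed

text \<open>The terms of the frame series are those of the \<open>l2_module\<close> inner product,
  so the frame conditions become membership in the carrier and an upper bound.\<close>

lemma ip_transform:
  assumes x: "x \<in> mcarrier H"
  shows "ip H (transform x n) (transform x n) = (\<omega> n)\<^sup>2 * (habs H (orth_proj H (K n) x))\<^sup>2"
proof -
  define p where "p = orth_proj H (K n) x"
  have p: "p \<in> mcarrier H" using x by (simp add: p_def orth_proj_closed complemented)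
  have "ip H (act H (\<omega> n) p) (act H (\<omega> n) p) = \<omega> n * (ip H p p * \<omega> n)"
    using p by (simp add: ip_act ip_act_right act_closed weight_star mult.assoc)
  also have "\<dots> = (\<omega> n)\<^sup>2 * ip H p p"
    unfolding weight_commute[of n "ip H p p", symmetric] by (simp add: power2_eq_square mult.assoc)
  finally show ?thesis
    by (simp add: frame_transform_def habs_power2 p flip: p_def)
qed

lemma transform_summable:
  assumes "x \<in> mcarrier H"
  shows "summable (\<lambda>n. ip H (transform x n) (transform x n))"
  using frame assms unfolding ip_transform[OF assms] star_fusion_frame_def by blast

lemma transform_in_l2: "x \<in> mcarrier H \<Longrightarrow> transform x \<in> mcarrier (l2_module H)"
  by (simp add: l2_module_def transform_closed transform_summable)

lemma transform_bound:
  obtains M where "0 \<le> M" "\<And>x. x \<in> mcarrier H \<Longrightarrow>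
    norm (\<Sum>n. ip H (transform x n) (transform x n)) \<le> M\<^sup>2 * norm (ip H x x)"
proof -
  obtain B where B: "\<And>x. x \<in> mcarrier H \<Longrightarrow>
      (\<Sum>n. (\<omega> n)\<^sup>2 * (habs H (orth_proj H (K n) x))\<^sup>2) \<preceq> (habs H (act H B x))\<^sup>2"
    using frame unfolding star_fusion_frame_def by blast
  show ?thesis
  proof (rule that[of "norm B"])
    fix x assume x: "x \<in> mcarrier H"
    have "(\<Sum>n. ip H (transform x n) (transform x n)) \<preceq> ip H (act H B x) (act H B x)"
      using B[OF x] by (simp add: ip_transform[OF x] habs_power2 act_closed x)
    then have "norm (\<Sum>n. ip H (transform x n) (transform x n)) \<le> norm (ip H (act H B x) (act H B x))"
      by (intro cstar_norm_mono suminf_cstar_positive transform_summable ip_positive transform_closed x)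
    then show "norm (\<Sum>n. ip H (transform x n) (transform x n)) \<le> (norm B)\<^sup>2 * norm (ip H x x)"
      using norm_ip_act_le[OF x, of B] by linarith
  qed simp
qed

lemma bounded_linear_transform: "bounded_linear_operator H (l2_module H) transform"
proof -
  obtain M where M: "0 \<le> M" "\<And>x. x \<in> mcarrier H \<Longrightarrow>
      norm (\<Sum>n. ip H (transform x n) (transform x n)) \<le> M\<^sup>2 * norm (ip H x x)"
    using transform_bound by blast
  have "hnorm (l2_module H) (transform x) \<le> M * hnorm H x" if x: "x \<in> mcarrier H" for x
  proof -
    have "hnorm (l2_module H) (transform x) \<le> sqrt (M\<^sup>2 * norm (ip H x x))"
      unfolding hnorm_l2_module[OF transform_in_l2[OF x]] using M(2)[OF x] by simp
    then show ?thesis using M(1) by (simp add: real_sqrt_mult hnorm_eq[OF x])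
  qed
  moreover have "transform (x + y) = transform x + transform y"
    if "x \<in> mcarrier H" "y \<in> mcarrier H" for x y
    by (rule ext) (simp add: transform_add that)
  moreover have "transform (act H a x) = act (l2_module H) a (transform x)"
    if "x \<in> mcarrier H" for a x
    by (rule ext) (simp add: transform_act that l2_module_def)
  ultimately show ?thesis
    unfolding bounded_linear_operator_def using transform_in_l2 by blast
qed

text \<open>
  For \<open>u = \<Sum>n\<in>F. \<omega>\<^sub>n P\<^sub>n y\<^sub>n\<close> one has \<open>\<langle>u, u\<rangle> = \<Sum>n\<in>F. \<langle>y\<^sub>n, \<omega>\<^sub>n P\<^sub>n u\<rangle>\<close>; by Cauchy-Schwarz and the upper
  frame bound, \<open>\<parallel>u\<parallel>\<close> is controlled by the \<open>l\<^sub>2\<close> norm of \<open>y\<close> on \<open>F\<close>.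
\<close>

lemma synthesis_block_bound:
  obtains C where "0 < C" "\<And>F y. \<lbrakk>finite F; \<And>n. y n \<in> mcarrier H\<rbrakk> \<Longrightarrow>
    (hnorm H (\<Sum>n\<in>F. transform (y n) n))\<^sup>2 \<le> C * norm (\<Sum>n\<in>F. ip H (y n) (y n))"
proof -
  obtain M where M: "0 \<le> M" "\<And>x. x \<in> mcarrier H \<Longrightarrow>
      norm (\<Sum>n. ip H (transform x n) (transform x n)) \<le> M\<^sup>2 * norm (ip H x x)"
    using transform_bound by blast
  show ?thesis
  \<comment> \<open>16 comes from Cauchy-Schwarz and \<open>M^2\<close> from the frame bound; adding
    1 makes the constant positive, so that it can be divided by.\<close>
  proof (rule that[of "16 * M\<^sup>2 + 1"])
    fix F :: "nat set" and y :: "nat \<Rightarrow> 'h" assume F: "finite F" and y: "\<And>n. y n \<in> mcarrier H"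
    define u where "u = (\<Sum>n\<in>F. transform (y n) n)"
    define q where "q = norm (ip H u u)"
    define Y where "Y = norm (\<Sum>n\<in>F. ip H (y n) (y n))"
    have u: "u \<in> mcarrier H" unfolding u_def by (intro sum_closed transform_closed y)
    have "ip H u u = (\<Sum>n\<in>F. ip H (transform (y n) n) u)"
      by (subst (1) u_def) (intro ip_sum_left transform_closed y u)
    also have "\<dots> = (\<Sum>n\<in>F. ip H (y n) (transform u n))"
      by (intro sum.cong refl transform_self_adjoint y u)
    finally have "q\<^sup>2 \<le> 16 * Y * norm (\<Sum>n\<in>F. ip H (transform u n) (transform u n))"
      unfolding q_def Y_def using ip_sum_cauchy_schwarz[of F y "transform u"] y transform_closed[OF u]
      by simp
    also have "norm (\<Sum>n\<in>F. ip H (transform u n) (transform u n))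
        \<le> norm (\<Sum>n. ip H (transform u n) (transform u n))"
      by (intro cstar_norm_mono cstar_positive_sum sum_le_suminf_cstar transform_summable
        ip_positive transform_closed u F)
    also have "\<dots> \<le> M\<^sup>2 * q" using M(2)[OF u] by (simp add: q_def)
    finally have "q\<^sup>2 \<le> 16 * Y * (M\<^sup>2 * q)" by (simp add: Y_def mult_left_mono)
    then have "q * q \<le> (16 * M\<^sup>2 * Y) * q" by (simp add: power2_eq_square mult_ac)
    moreover have "0 \<le> q" "0 \<le> Y" by (simp_all add: q_def Y_def)
    ultimately have "q \<le> 16 * M\<^sup>2 * Y" by (cases "q = 0") auto
    then show "(hnorm H u)\<^sup>2 \<le> (16 * M\<^sup>2 + 1) * Y"
      using \<open>0 \<le> q\<close> \<open>0 \<le> Y\<close> by (simp add: hnorm_eq[OF u] distrib_right flip: q_def)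
  qed (simp add: add_nonneg_pos)
qed

text \<open>The block constant is independent of \<open>F\<close>, so the blocks
  \<open>{m..<n}\<close> of the convergent series of \<open>ip H (y n) (y n)\<close> make the
  partial sums Cauchy; \<open>H\<close> is complete.\<close>

lemma synthesis_hsums:
  assumes y: "y \<in> mcarrier (l2_module H)"
  shows "\<exists>l. hsums H (\<lambda>n. transform (y n) n) l"
proof -
  have yc: "y n \<in> mcarrier H" for n using y by (simp add: l2_module_def)
  have ys: "summable (\<lambda>n. ip H (y n) (y n))" using y by (simp add: l2_module_def)
  define s where "s N = (\<Sum>n<N. transform (y n) n)" for N
  have s: "s N \<in> mcarrier H" for N unfolding s_def by (intro sum_closed transform_closed yc)
  obtain C where C: "0 < C" "\<And>F y. \<lbrakk>finite F; \<And>n. y n \<in> mcarrier H\<rbrakk> \<Longrightarrow>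
      (hnorm H (\<Sum>n\<in>F. transform (y n) n))\<^sup>2 \<le> C * norm (\<Sum>n\<in>F. ip H (y n) (y n))"
    using synthesis_block_bound by blast
  have "hcauchy H s"
    unfolding hcauchy_def
  proof (intro allI impI)
    fix e :: real assume e: "0 < e"
    then have "0 < e\<^sup>2 / C" using C(1) by simp
    then obtain N where N: "\<And>m n. N \<le> m \<Longrightarrow> norm (\<Sum>i\<in>{m..<n}. ip H (y i) (y i)) < e\<^sup>2 / C"
      using ys unfolding summable_Cauchy by blast
    have le: "hnorm H (s n - s m) < e" if "N \<le> m" "m \<le> n" for m n
    proof -
      have "s n - s m = (\<Sum>i\<in>{m..<n}. transform (y i) i)"
        unfolding s_def lessThan_atLeast0 by (rule sum_diff_nat_ivl) (use that in auto)
      then have "(hnorm H (s n - s m))\<^sup>2 \<le> C * norm (\<Sum>i\<in>{m..<n}. ip H (y i) (y i))"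
        using C(2)[of "{m..<n}" y] yc by simp
      also have "\<dots> < C * (e\<^sup>2 / C)" using N[OF that(1), of n] C(1) by (intro mult_strict_left_mono)
      also have "\<dots> = e\<^sup>2" using C(1) by simp
      finally show ?thesis by (rule power2_less_imp_less) (use e in simp)
    qed
    have "hnorm H (s m - s n) < e" if "N \<le> m" "N \<le> n" for m n
    proof (cases "m \<le> n")
      case True
      have "hnorm H (s m - s n) = hnorm H (s n - s m)"
        using hnorm_uminus[OF diff_closed[OF s s], of n m] by simp
      with le[OF that(1) True] show ?thesis by simp
    qed (use le that in auto)
    then show "\<exists>N. \<forall>m\<ge>N. \<forall>n\<ge>N. hnorm H (s m - s n) < e" by blast
  qed
  then obtain l where "htendsto H s l" using complete[of s] s by blast
  then show ?thesis unfolding hsums_def s_def by blast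
qed

text \<open>Continuity of the inner product at the limit \<open>S y\<close> also yields convergence
  of the series that defines the \<open>l2_module\<close> inner product, so its
  \<open>suminf\<close> is a genuine sum.\<close>

lemma is_adjoint_synthesis:
  assumes S: "\<And>y. y \<in> mcarrier (l2_module H) \<Longrightarrow> hsums H (\<lambda>n. transform (y n) n) (S y)"
  shows "is_adjoint H (l2_module H) transform S"
  unfolding is_adjoint_def
proof (intro conjI ballI funcsetI)
  fix y assume y: "y \<in> mcarrier (l2_module H)"
  then have yc: "y n \<in> mcarrier H" for n by (simp add: l2_module_def)
  show "S y \<in> mcarrier H" using S[OF y] by (simp add: hsums_def htendsto_def)
  fix u assume u: "u \<in> mcarrier H"
  have "(\<lambda>N. ip H u (\<Sum>n<N. transform (y n) n)) \<longlonglongrightarrow> ip H u (S y)"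
    using S[OF y] unfolding hsums_def by (intro tendsto_ip_right sum_closed transform_closed yc u)
  moreover have "ip H u (\<Sum>n<N. transform (y n) n) = (\<Sum>n<N. ip H (transform u n) (y n))" for N
    by (simp add: ip_sum_right transform_closed yc u transform_self_adjoint)
  ultimately have "(\<lambda>n. ip H (transform u n) (y n)) sums ip H u (S y)"
    by (simp add: sums_def)
  then show "ip (l2_module H) (transform u) y = ip H u (S y)"
    by (simp add: l2_module_def sums_iff)
qed

end

theorem theorem3p3:
  fixes H :: "('a::unital_cstar_algebra, 'h::ab_group_add) cmodule"
    and K :: "nat \<Rightarrow> 'h set"
    and \<omega> :: "nat \<Rightarrow> 'a"
  assumes "hilbert_module H"
    and "star_fusion_frame H K \<omega>"
  shows "bounded_linear_operator H (l2_module H) (frame_transform H K \<omega>) \<and>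
         adjointable H (l2_module H) (frame_transform H K \<omega>) \<and>
         (\<forall>y\<in>mcarrier (l2_module H).
           hsums H (\<lambda>n. act H (\<omega> n) (orth_proj H (K n) (y n)))
             (adjoint_op H (l2_module H) (frame_transform H K \<omega>) y))"
proof -
  interpret fusion_frame H K \<omega>
    using assms by (simp add: fusion_frame_def fusion_frame_axioms_def)
  define S where "S y = (SOME l. hsums H (\<lambda>n. transform (y n) n) l)" for y
  have S: "hsums H (\<lambda>n. transform (y n) n) (S y)" if "y \<in> mcarrier (l2_module H)" for y
    unfolding S_def by (rule someI_ex[OF synthesis_hsums[OF that]])
  have adj: "is_adjoint H (l2_module H) transform S" by (rule is_adjoint_synthesis[OF S])
  have "adjointable H (l2_module H) transform"
    unfolding adjointable_def using adj transform_in_l2 by blast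
  moreover have "hsums H (\<lambda>n. act H (\<omega> n) (orth_proj H (K n) (y n)))
      (adjoint_op H (l2_module H) transform y)" if y: "y \<in> mcarrier (l2_module H)" for y
    using S[OF y] is_adjoint_eq_adjoint_op[OF adj y] by (simp add: frame_transform_def)
  ultimately show ?thesis using bounded_linear_transform by blast
qed

end
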